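(* Let $G$ be a finite perfect group and $n\geq 2$ a natural number. There exists a short exact sequence $$1\to\widetilde G\to\widetilde{\mathcal K}(G,n)\to G^{n-1}\to 1,$$ where $\widetilde G$ denotes the universal central extension of $G$.
   Context: For a group $G$ and $n\geq 2$, let $G^{\rm ab}=G/[G,G]$ and let $\mathcal K(G,n)$ be the kernel of the homomorphism $G^n\to G^{\rm ab}$, $(g_1,\dots,g_n)\mapsto\overline{g_1\cdots g_n}$. Choose a presentation $G\cong F/N$ with $F$ a free group and $N$ a normal subgroup of $F$. Let $\langle\langle\mathcal K(N,n)\rangle\rangle$ be the normal closure of $\mathcal K(N,n)$ in $F^n$ (it is contained in $\mathcal K(F,n)$), and define $\widetilde{\mathcal K}(G,n):=\mathcal K(F,n)/\langle\langle\mathcal K(N,n)\rangle\rangle$. Up to isomorphism this does not depend on the choice of presentation. A cover of a finite group $G$ is a group $G^\ast$ together with a central short exact sequence $0\to M\to G^\ast\to G\to 1$ such that $M\leq[G^\ast,G^\ast]$ and $M$ is isomorphic to the Schur multiplier $H^2(G,\mathbb C^\ast)$ of $G$. A finite perfect group has a unique cover up to isomorphism, called its universal central extension. *)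

theory Defs
  imports Complex_Main "HOL-Algebra.Algebra"
begin

subsection \<open>Exact sequences\<close>

text \<open>The predicate \<open>exact_seq\<close> of \<open>HOL-Algebra\<close> forces all groups of a sequence to have the same
  element type, which is not the case here.\<close>

definition short_exact ::
  "('a, 'r) monoid_scheme \<Rightarrow> ('b, 's) monoid_scheme \<Rightarrow> ('c, 't) monoid_scheme \<Rightarrow>
   ('a \<Rightarrow> 'b) \<Rightarrow> ('b \<Rightarrow> 'c) \<Rightarrow> bool" where
  "short_exact A B C f g \<longleftrightarrow>
     group A \<and> group B \<and> group C \<and> f \<in> mon A B \<and> g \<in> epi B C \<and>
     f ` carrier A = kernel B C g"

subsection \<open>Perfect groups, abelianisation, normal closure\<close>

definition perfect_group :: "('a, 'r) monoid_scheme \<Rightarrow> bool" where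
  "perfect_group G \<longleftrightarrow> group G \<and> derived G (carrier G) = carrier G"

definition abelianization :: "('a, 'r) monoid_scheme \<Rightarrow> 'a set monoid" where
  "abelianization G = G Mod derived G (carrier G)"

definition normal_closure :: "('a, 'r) monoid_scheme \<Rightarrow> 'a set \<Rightarrow> 'a set" where
  "normal_closure G S = \<Inter> {H. H \<lhd> G \<and> S \<subseteq> H}"

subsection \<open>Free groups\<close>

text \<open>A word is a list of letters \<open>(s, x)\<close>, standing for the generator \<open>x\<close> if \<open>s\<close> holds and for the
  inverse of \<open>x\<close> otherwise.  A group is free on \<open>B\<close> if each of its elements is the value of
  exactly one reduced word over \<open>B\<close>.\<close>

definition reduced_words :: "'a set \<Rightarrow> (bool \<times> 'a) list set" where
  "reduced_words B =
     {w. set w \<subseteq> UNIV \<times> B \<and>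
         successively (\<lambda>(s, x) (t, y). \<not> (x = y \<and> s \<noteq> t)) w}"

definition word_value :: "('a, 'r) monoid_scheme \<Rightarrow> (bool \<times> 'a) list \<Rightarrow> 'a" where
  "word_value F w =
     foldr (\<lambda>(s, x) g. (if s then x else inv\<^bsub>F\<^esub> x) \<otimes>\<^bsub>F\<^esub> g) w \<one>\<^bsub>F\<^esub>"

definition free_group :: "('a, 'r) monoid_scheme \<Rightarrow> bool" where
  "free_group F \<longleftrightarrow>
     group F \<and>
     (\<exists>B \<subseteq> carrier F. bij_betw (word_value F) (reduced_words B) (carrier F))"

subsection \<open>The groups K(G,n) and their tilde versions\<close>

abbreviation group_power :: "('a, 'r) monoid_scheme \<Rightarrow> nat \<Rightarrow> (nat \<Rightarrow> 'a) monoid" where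
  "group_power G n \<equiv> product_group {1..n} (\<lambda>_. G)"

definition ordered_product :: "('a, 'r) monoid_scheme \<Rightarrow> nat \<Rightarrow> (nat \<Rightarrow> 'a) \<Rightarrow> 'a" where
  "ordered_product G n g = foldr (\<lambda>i h. g i \<otimes>\<^bsub>G\<^esub> h) [1..<Suc n] \<one>\<^bsub>G\<^esub>"

definition K_subgroup :: "('a, 'r) monoid_scheme \<Rightarrow> nat \<Rightarrow> (nat \<Rightarrow> 'a) set" where
  "K_subgroup G n =
     kernel (group_power G n) (abelianization G)
       (\<lambda>g. derived G (carrier G) #>\<^bsub>G\<^esub> ordered_product G n g)"

definition K_tilde ::
  "('a, 'r) monoid_scheme \<Rightarrow> 'a set \<Rightarrow> nat \<Rightarrow> (nat \<Rightarrow> 'a) set monoid" where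
  "K_tilde F N n =
     (group_power F n)\<lparr>carrier := K_subgroup F n\<rparr> Mod
       normal_closure (group_power F n) (K_subgroup (F\<lparr>carrier := N\<rparr>) n)"

subsection \<open>Schur multiplier and covers\<close>

text \<open>Inhomogeneous cochains, with coefficients in an abelian group \<open>A\<close> (written
  multiplicatively) on which \<open>G\<close> acts trivially; cochains are not required to be normalised.\<close>

definition cochains2 ::
  "('a, 'r) monoid_scheme \<Rightarrow> ('b, 's) monoid_scheme \<Rightarrow> ('a \<times> 'a \<Rightarrow> 'b) monoid" where
  "cochains2 G A = product_group (carrier G \<times> carrier G) (\<lambda>_. A)"

definition cocycles2 ::
  "('a, 'r) monoid_scheme \<Rightarrow> ('b, 's) monoid_scheme \<Rightarrow> ('a \<times> 'a \<Rightarrow> 'b) set" where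
  "cocycles2 G A =
     {f \<in> carrier (cochains2 G A).
        \<forall>g \<in> carrier G. \<forall>h \<in> carrier G. \<forall>k \<in> carrier G.
          f (h, k) \<otimes>\<^bsub>A\<^esub> f (g, h \<otimes>\<^bsub>G\<^esub> k) = f (g \<otimes>\<^bsub>G\<^esub> h, k) \<otimes>\<^bsub>A\<^esub> f (g, h)}"

definition coboundaries2 ::
  "('a, 'r) monoid_scheme \<Rightarrow> ('b, 's) monoid_scheme \<Rightarrow> ('a \<times> 'a \<Rightarrow> 'b) set" where
  "coboundaries2 G A =
     {f \<in> carrier (cochains2 G A).
        \<exists>c \<in> carrier G \<rightarrow> carrier A. \<forall>g \<in> carrier G. \<forall>h \<in> carrier G.
          f (g, h) = c h \<otimes>\<^bsub>A\<^esub> inv\<^bsub>A\<^esub> c (g \<otimes>\<^bsub>G\<^esub> h) \<otimes>\<^bsub>A\<^esub> c g}"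

definition cohomology2 ::
  "('a, 'r) monoid_scheme \<Rightarrow> ('b, 's) monoid_scheme \<Rightarrow> ('a \<times> 'a \<Rightarrow> 'b) set monoid" where
  "cohomology2 G A = (cochains2 G A)\<lparr>carrier := cocycles2 G A\<rparr> Mod coboundaries2 G A"

definition complex_units :: "complex monoid" where
  "complex_units = \<lparr>carrier = UNIV - {0}, monoid.mult = (*), one = 1\<rparr>"

definition schur_multiplier ::
  "('a, 'r) monoid_scheme \<Rightarrow> ('a \<times> 'a \<Rightarrow> complex) set monoid" where
  "schur_multiplier G = cohomology2 G complex_units"

definition central_extension ::
  "('m, 'r) monoid_scheme \<Rightarrow> ('e, 's) monoid_scheme \<Rightarrow> ('g, 't) monoid_scheme \<Rightarrow>
   ('m \<Rightarrow> 'e) \<Rightarrow> ('e \<Rightarrow> 'g) \<Rightarrow> bool" where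
  "central_extension M E G i p \<longleftrightarrow>
     short_exact M E G i p \<and>
     (\<forall>m \<in> carrier M. \<forall>e \<in> carrier E. i m \<otimes>\<^bsub>E\<^esub> e = e \<otimes>\<^bsub>E\<^esub> i m)"

text \<open>For a finite perfect group \<open>G\<close> the group \<open>E\<close> in a cover is unique up to isomorphism; it is
  the universal central extension of \<open>G\<close>.\<close>

definition is_cover ::
  "('m, 'r) monoid_scheme \<Rightarrow> ('e, 's) monoid_scheme \<Rightarrow> ('g, 't) monoid_scheme \<Rightarrow>
   ('m \<Rightarrow> 'e) \<Rightarrow> ('e \<Rightarrow> 'g) \<Rightarrow> bool" where
  "is_cover M E G i p \<longleftrightarrow>
     central_extension M E G i p \<and>
     i ` carrier M \<subseteq> derived E (carrier E) \<and>
     M \<cong> schur_multiplier G"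

end

theory Submission
  imports Defs
begin

text \<open>
  Let \<open>q : F \<rightarrow> G\<close> be the presentation, with kernel \<open>N\<close>, and write \<open>D = [F, F]\<close> and \<open>C = [F, N]\<close>.
  Three observations give the theorem.

  The relations of \<open>K_tilde F N n\<close> are transparent: the normal closure of \<open>\<K>(N, n)\<close> in \<open>F\<^sup>n\<close> consists of
  the tuples over \<open>N\<close> whose product lies in \<open>C\<close> (\<open>normal_closure_K_subgroup\<close>).  Conjugating one
  coordinate of \<open>(y\<^sup>-\<^sup>1, 1, \<dots>, 1, y)\<close> changes the product by a commutator \<open>[x, y]\<close>, which produces \<open>C\<close>;
  nothing more arises because \<open>N\<close> is central modulo \<open>C\<close>.

  Map the class of a tuple \<open>f\<close> to \<open>(q f\<^sub>1, \<dots>, q f\<^sub>n\<^sub>-\<^sub>1)\<close>.  This is onto \<open>G\<^sup>n\<^sup>-\<^sup>1\<close> since the last coordinate can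
  be used to make the product trivial.  In its kernel every tuple is equivalent to \<open>(1, \<dots>, 1, d)\<close>, where
  \<open>d \<in> D\<close> is the product of the tuple, and two such tuples are equivalent exactly if they agree
  modulo \<open>C\<close>.  So the kernel is \<open>D/C\<close> (\<open>K_tilde_short_exact\<close>).

  Finally \<open>D/C\<close> is the given cover \<open>E\<close> (\<open>cover_of_presentation\<close>).  As \<open>F\<close> is free, \<open>q\<close> lifts to
  \<open>\<phi> : F \<rightarrow> E\<close>, and perfectness of \<open>G\<close> makes \<open>D/C\<close> a perfect central extension \<open>U\<close> of \<open>G\<close> which \<open>\<phi>\<close> maps
  onto \<open>E\<close>.  Injectivity is a counting argument with characters (\<open>cover_surjection_injective\<close>).  Let \<open>R\<close> and
  \<open>K\<close> be the kernels of \<open>U \<rightarrow> G\<close> and \<open>E \<rightarrow> G\<close>.  Pushing the extension \<open>U\<close> out along a character of \<open>R\<close>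
  gives a class in \<open>H\<^sup>2(G, \<complex>\<^sup>*)\<close>, and this is injective because \<open>U\<close> is perfect, so \<open>R\<close> has at most
  \<open>|H\<^sup>2(G, \<complex>\<^sup>*)| = |K|\<close> characters.  The \<open>|K|\<close> characters of \<open>K\<close> pull back to distinct characters of \<open>R\<close>.
  Hence all characters of \<open>R\<close> vanish on the kernel of \<open>R \<rightarrow> K\<close>, and as characters separate points,
  that kernel is trivial.
\<close>

section \<open>Commutators and the subgroup \<open>[G, N]\<close>\<close>

lemma (in group) inv_cancel_left:
  assumes "x \<in> carrier G" "y \<in> carrier G"
  shows "inv x \<otimes> (x \<otimes> y) = y" "x \<otimes> (inv x \<otimes> y) = y"
  using assms by (simp_all add: m_assoc[symmetric])

text \<open>These rules bring a group word into right-nested form, move inverses to the letters and cancel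
  neighbouring inverse letters; two words that are equal in every group get the same normal form.\<close>

lemmas (in group) group_word_simps = m_assoc inv_mult_group inv_cancel_left

abbreviation commutator :: "('a, 'r) monoid_scheme \<Rightarrow> 'a \<Rightarrow> 'a \<Rightarrow> 'a" where
  "commutator G x y \<equiv> x \<otimes>\<^bsub>G\<^esub> y \<otimes>\<^bsub>G\<^esub> inv\<^bsub>G\<^esub> x \<otimes>\<^bsub>G\<^esub> inv\<^bsub>G\<^esub> y"

text \<open>In \<open>[am, bn] = (am)(bn) ((bn)(am))\<^sup>-\<^sup>1\<close> both factors carry the same central element \<open>mn\<close>.\<close>

lemma (in group) commutator_mult_central:
  assumes "a \<in> carrier G" "b \<in> carrier G" "m \<in> carrier G" "n \<in> carrier G"
    and m: "\<And>x. x \<in> carrier G \<Longrightarrow> m \<otimes> x = x \<otimes> m" and n: "\<And>x. x \<in> carrier G \<Longrightarrow> n \<otimes> x = x \<otimes> n"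
  shows "commutator G (a \<otimes> m) (b \<otimes> n) = commutator G a b"
proof -
  have ab: "a \<otimes> m \<otimes> (b \<otimes> n) = (a \<otimes> b) \<otimes> (m \<otimes> n)"
    using assms(1-4) m[of b] by (metis m_assoc m_closed)
  have ba: "b \<otimes> n \<otimes> (a \<otimes> m) = (b \<otimes> a) \<otimes> (m \<otimes> n)"
    using assms(1-4) n[of a] n[of m] by (metis m_assoc m_closed)
  have "commutator G (a \<otimes> m) (b \<otimes> n) = (a \<otimes> m \<otimes> (b \<otimes> n)) \<otimes> inv (b \<otimes> n \<otimes> (a \<otimes> m))"
    using assms(1-4) by (simp add: group_word_simps)
  also have "\<dots> = commutator G a b"
    unfolding ab ba using assms(1-4) by (simp add: group_word_simps)
  finally show ?thesis .
qed

lemma (in group_hom) hom_commutator: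
  "x \<in> carrier G \<Longrightarrow> y \<in> carrier G \<Longrightarrow> h (commutator G x y) = commutator H (h x) (h y)"
  by simp

text \<open>This is the subgroup \<open>[G, N]\<close>.\<close>

definition commutator_with :: "('a, 'r) monoid_scheme \<Rightarrow> 'a set \<Rightarrow> 'a set" where
  "commutator_with G N = generate G {commutator G x y |x y. x \<in> carrier G \<and> y \<in> N}"

context group
begin

lemma commutator_in_derived:
  "x \<in> carrier G \<Longrightarrow> y \<in> carrier G \<Longrightarrow> commutator G x y \<in> derived G (carrier G)"
  unfolding derived_def by (rule generate.incl) blast

lemma derived_subsetI:
  assumes "subgroup H G" "\<And>x y. x \<in> carrier G \<Longrightarrow> y \<in> carrier G \<Longrightarrow> commutator G x y \<in> H"
  shows "derived G (carrier G) \<subseteq> H"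
  unfolding derived_def using assms by (intro generate_subgroup_incl) auto

lemma commutator_in_commutator_with:
  "x \<in> carrier G \<Longrightarrow> y \<in> N \<Longrightarrow> commutator G x y \<in> commutator_with G N"
  unfolding commutator_with_def by (rule generate.incl) blast

lemma commutator_with_subsetI:
  assumes "subgroup H G" "\<And>x y. x \<in> carrier G \<Longrightarrow> y \<in> N \<Longrightarrow> commutator G x y \<in> H"
  shows "commutator_with G N \<subseteq> H"
  unfolding commutator_with_def using assms by (intro generate_subgroup_incl) auto

lemma commutator_with_subset_normal:
  assumes "N \<lhd> G"
  shows "commutator_with G N \<subseteq> N"
proof (rule commutator_with_subsetI)
  interpret normal N G by fact
  show "subgroup N G" by (rule normal_imp_subgroup[OF assms])
  show "commutator G x y \<in> N" if "x \<in> carrier G" "y \<in> N" for x y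
    using that inv_op_closed2[OF that] by auto
qed

lemma normal_commutator_with:
  assumes "N \<lhd> G"
  shows "commutator_with G N \<lhd> G"
  unfolding commutator_with_def
proof (rule normal_generateI)
  interpret normal N G by fact
  show "{commutator G x y |x y. x \<in> carrier G \<and> y \<in> N} \<subseteq> carrier G" by auto
  fix c g assume "c \<in> {commutator G x y |x y. x \<in> carrier G \<and> y \<in> N}" and g: "g \<in> carrier G"
  then obtain x y where c: "c = commutator G x y" "x \<in> carrier G" "y \<in> N" by blast
  have "g \<otimes> c \<otimes> inv g = commutator G (g \<otimes> x \<otimes> inv g) (g \<otimes> y \<otimes> inv g)"
    using c g by (simp add: group_word_simps)
  moreover have "g \<otimes> y \<otimes> inv g \<in> N" using inv_op_closed2[OF g c(3)] .
  ultimately show "g \<otimes> c \<otimes> inv g \<in> {commutator G x y |x y. x \<in> carrier G \<and> y \<in> N}"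
    using c(2) g by (intro CollectI exI[of _ "g \<otimes> x \<otimes> inv g"] exI[of _ "g \<otimes> y \<otimes> inv g"]) simp
qed

lemma commutator_with_subset_derived:
  assumes "N \<subseteq> carrier G"
  shows "commutator_with G N \<subseteq> derived G (carrier G)"
  using assms by (intro commutator_with_subsetI derived_is_subgroup)
    (auto intro: commutator_in_derived)

text \<open>The two products differ by the generator \<open>[x, y]\<close>, so \<open>N\<close> is central modulo \<open>[G, N]\<close>.\<close>

lemma commutator_with_central:
  assumes N: "N \<lhd> G" and x: "x \<in> carrier G" and y: "y \<in> N"
  shows "commutator_with G N #> (y \<otimes> x) = commutator_with G N #> (x \<otimes> y)"
proof (rule repr_independence)
  show "subgroup (commutator_with G N) G"
    by (rule normal_imp_subgroup[OF normal_commutator_with[OF N]])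
  have yG: "y \<in> carrier G" using y N by (meson normal_imp_subgroup subgroup.mem_carrier)
  show "y \<otimes> x \<in> carrier G" using x yG by simp
  show "x \<otimes> y \<in> commutator_with G N #> (y \<otimes> x)"
  proof -
    have "x \<otimes> y = commutator G x y \<otimes> (y \<otimes> x)" using x yG by (simp add: group_word_simps)
    then show ?thesis using commutator_in_commutator_with[OF x y] by (auto simp: r_coset_def)
  qed
qed

end

section \<open>Characters of abelian groups\<close>

lemma complex_units_simps [simp]:
  "carrier complex_units = UNIV - {0}" "x \<otimes>\<^bsub>complex_units\<^esub> y = x * y" "\<one>\<^bsub>complex_units\<^esub> = 1"
  by (simp_all add: complex_units_def)

lemma comm_group_complex_units: "comm_group complex_units"
proof (rule comm_groupI)
  fix x assume "x \<in> carrier complex_units"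
  then show "\<exists>y\<in>carrier complex_units. y \<otimes>\<^bsub>complex_units\<^esub> x = \<one>\<^bsub>complex_units\<^esub>"
    by (intro bexI[of _ "inverse x"]) auto
qed auto

lemma group_complex_units [simp]: "group complex_units"
  using comm_group_complex_units by (simp add: comm_group_def)

lemma inv_complex_units [simp]: "x \<noteq> 0 \<Longrightarrow> inv\<^bsub>complex_units\<^esub> x = inverse x"
  by (rule group.inv_equality) auto

lemma nat_pow_complex_units [simp]: "x [^]\<^bsub>complex_units\<^esub> (k::nat) = x ^ k"
  by (induction k) auto

text \<open>A character of a subgroup of \<open>A\<close>, given by its graph: a subgroup of \<open>A \<times> \<complex>\<^sup>*\<close> is the graph of a
  function if and only if it meets \<open>1 \<times> \<complex>\<^sup>*\<close> trivially.  In this form the union of a chain of partial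
  characters is again one.\<close>

definition partial_character :: "('a, 'r) monoid_scheme \<Rightarrow> ('a \<times> complex) set \<Rightarrow> bool" where
  "partial_character A \<Gamma> \<longleftrightarrow>
     subgroup \<Gamma> (A \<times>\<times> complex_units) \<and> (\<forall>z. (\<one>\<^bsub>A\<^esub>, z) \<in> \<Gamma> \<longrightarrow> z = 1)"

text \<open>Adjoin a pair \<open>(h, z)\<close> to the graph.  If \<open>n > 0\<close> is the least exponent for which \<open>h\<^sup>n\<close> is in the
  domain, then \<open>z\<close> may be any \<open>n\<close>-th root of the value at \<open>h\<^sup>n\<close>; if there is no such exponent, \<open>z\<close>
  is arbitrary.  As \<open>h\<close> itself is outside the domain, \<open>n \<ge> 2\<close>, so that one of the roots differs from 1.\<close>

lemma partial_character_extension: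
  assumes A: "comm_group A" and \<Gamma>: "partial_character A \<Gamma>"
    and h: "h \<in> carrier A" "h \<notin> fst ` \<Gamma>"
  obtains \<Gamma>' z where "partial_character A \<Gamma>'" "\<Gamma> \<subseteq> \<Gamma>'" "(h, z) \<in> \<Gamma>'" "z \<noteq> 1"
proof -
  interpret A: comm_group A by fact
  define P where "P = A \<times>\<times> complex_units"
  interpret P: group P
    unfolding P_def by (simp add: DirProd_group A.is_group)
  have P_comm: "a \<otimes>\<^bsub>P\<^esub> b = b \<otimes>\<^bsub>P\<^esub> a" if "a \<in> carrier P" "b \<in> carrier P" for a b
    using that by (auto simp: P_def A.m_comm)
  interpret P: comm_group P
    by (rule P.group_comm_groupI) (rule P_comm)
  have sub: "subgroup \<Gamma> P" using \<Gamma> by (simp add: partial_character_def P_def)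
  interpret S: subgroup \<Gamma> P by fact
  have fst_hom: "fst \<in> hom P A" by (auto simp: hom_def P_def)
  interpret f: group_hom P A fst using fst_hom by unfold_locales
  have dom: "subgroup (fst ` \<Gamma>) A"
    by (rule f.subgroup_img_is_subgroup[OF sub])
  have "\<exists>z. z \<noteq> 0 \<and> z \<noteq> 1 \<and> (\<forall>k::int. h [^]\<^bsub>A\<^esub> k \<in> fst ` \<Gamma> \<longrightarrow> (h, z) [^]\<^bsub>P\<^esub> k \<in> \<Gamma>)"
  proof (cases "\<exists>n::nat. n > 0 \<and> h [^]\<^bsub>A\<^esub> n \<in> fst ` \<Gamma>")
    case False
    have "k = 0" if "h [^]\<^bsub>A\<^esub> k \<in> fst ` \<Gamma>" for k :: int
    proof (rule ccontr)
      assume "k \<noteq> 0"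
      have "h [^]\<^bsub>A\<^esub> \<bar>k\<bar> \<in> fst ` \<Gamma>"
        using that subgroup.m_inv_closed[OF dom that] h by (auto simp: abs_if A.int_pow_neg)
      then have "h [^]\<^bsub>A\<^esub> (nat \<bar>k\<bar>) \<in> fst ` \<Gamma>"
        by (metis int_pow_int int_nat_eq abs_ge_zero)
      moreover have "nat \<bar>k\<bar> > 0" using \<open>k \<noteq> 0\<close> by simp
      ultimately show False using False by blast
    qed
    then have "(h, -1) [^]\<^bsub>P\<^esub> k \<in> \<Gamma>" if "h [^]\<^bsub>A\<^esub> k \<in> fst ` \<Gamma>" for k :: int
      using that S.one_closed by force
    then show ?thesis
      by (intro exI[of _ "-1"]) simp
  next
    case True
    define n where "n = (LEAST n::nat. n > 0 \<and> h [^]\<^bsub>A\<^esub> n \<in> fst ` \<Gamma>)"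
    have n: "n > 0" "h [^]\<^bsub>A\<^esub> n \<in> fst ` \<Gamma>"
      using LeastI_ex[OF True] by (auto simp: n_def)
    have n_min: "\<not> (m > 0 \<and> h [^]\<^bsub>A\<^esub> m \<in> fst ` \<Gamma>)" if "m < n" for m
      using not_less_Least that by (auto simp: n_def)
    have "n \<noteq> 1" using n(2) h A.int_pow_1[OF h(1)] int_pow_int[of A h 1] by (metis of_nat_1)
    with n(1) have "n \<ge> 2" by simp
    obtain w where w: "(h [^]\<^bsub>A\<^esub> n, w) \<in> \<Gamma>" using n(2) by auto
    have "w \<noteq> 0" using S.subset w by (auto simp: P_def)
    have "card {z. z ^ n = w} = n"
      using card_nth_roots \<open>w \<noteq> 0\<close> n(1) by blast
    then have "\<not> {z. z ^ n = w} \<subseteq> {1}"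
      using \<open>n \<ge> 2\<close> card_mono[of "{1::complex}" "{z. z ^ n = w}"] by fastforce
    then obtain z where z: "z ^ n = w" "z \<noteq> 1" by auto
    have "z \<noteq> 0" using z(1) \<open>w \<noteq> 0\<close> n(1) by auto
    have hzP: "(h, z) \<in> carrier P" using h \<open>z \<noteq> 0\<close> by (simp add: P_def)
    have pow: "(h, z) [^]\<^bsub>P\<^esub> m = (h [^]\<^bsub>A\<^esub> m, z ^ m)" for m :: nat
      by (induction m) (auto simp: P_def)
    \<comment> \<open>division with remainder: minimality of \<open>n\<close> forces \<open>n\<close> to divide \<open>k\<close>\<close>
    have "(h, z) [^]\<^bsub>P\<^esub> k \<in> \<Gamma>" if k: "h [^]\<^bsub>A\<^esub> k \<in> fst ` \<Gamma>" for k :: int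
    proof -
      define j r where "j = k div int n" and "r = nat (k mod int n)"
      have k_eq: "k = int n * j + int r" and "r < n"
        using n(1) by (auto simp: j_def r_def nat_less_iff)
      have hn: "h [^]\<^bsub>A\<^esub> (int n * j) \<in> fst ` \<Gamma>"
        using A.subgroup_int_pow_closed[OF dom n(2), of j] h by (simp add: A.int_pow_pow flip: int_pow_int)
      have "h [^]\<^bsub>A\<^esub> int r = inv\<^bsub>A\<^esub> (h [^]\<^bsub>A\<^esub> (int n * j)) \<otimes>\<^bsub>A\<^esub> h [^]\<^bsub>A\<^esub> k"
        using h(1) unfolding k_eq A.int_pow_mult[OF h(1)] by (simp add: A.inv_solve_left)
      then have "h [^]\<^bsub>A\<^esub> r \<in> fst ` \<Gamma>"
        using subgroup.m_closed[OF dom subgroup.m_inv_closed[OF dom hn] k] by (simp add: int_pow_int)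
      then have "r = 0" using n_min[OF \<open>r < n\<close>] by (metis not_gr_zero)
      then have "(h, z) [^]\<^bsub>P\<^esub> k = ((h, z) [^]\<^bsub>P\<^esub> n) [^]\<^bsub>P\<^esub> j"
        using k_eq hzP by (simp add: P.int_pow_pow flip: int_pow_int)
      then show ?thesis
        using P.subgroup_int_pow_closed[OF sub] w pow z(1) by simp
    qed
    then show ?thesis using z(2) \<open>z \<noteq> 0\<close> by blast
  qed
  then obtain z where z: "z \<noteq> 0" "z \<noteq> 1"
    and zk: "\<And>k::int. h [^]\<^bsub>A\<^esub> k \<in> fst ` \<Gamma> \<Longrightarrow> (h, z) [^]\<^bsub>P\<^esub> k \<in> \<Gamma>" by blast
  have hzP: "(h, z) \<in> carrier P" using h z by (simp add: P_def)
  define \<Gamma>' where "\<Gamma>' = {\<gamma> \<otimes>\<^bsub>P\<^esub> (h, z) [^]\<^bsub>P\<^esub> (k::int) |\<gamma> k. \<gamma> \<in> \<Gamma>}"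
  have \<Gamma>'I: "\<gamma> \<otimes>\<^bsub>P\<^esub> (h, z) [^]\<^bsub>P\<^esub> k \<in> \<Gamma>'" if "\<gamma> \<in> \<Gamma>" for \<gamma> and k :: int
    using that unfolding \<Gamma>'_def by blast
  have inP: "\<gamma> \<in> carrier P" if "\<gamma> \<in> \<Gamma>" for \<gamma> using that S.subset by auto
  have "subgroup \<Gamma>' P"
  proof (rule P.subgroupI)
    show "\<Gamma>' \<subseteq> carrier P" using inP hzP by (auto simp: \<Gamma>'_def)
    show "\<Gamma>' \<noteq> {}" using \<Gamma>'I[OF S.one_closed] by blast
  next
    fix a assume "a \<in> \<Gamma>'"
    then obtain \<gamma> k where a: "a = \<gamma> \<otimes>\<^bsub>P\<^esub> (h, z) [^]\<^bsub>P\<^esub> (k::int)" "\<gamma> \<in> \<Gamma>" by (auto simp: \<Gamma>'_def)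
    have "inv\<^bsub>P\<^esub> a = inv\<^bsub>P\<^esub> \<gamma> \<otimes>\<^bsub>P\<^esub> (h, z) [^]\<^bsub>P\<^esub> (-k)"
      using a inP hzP by (simp add: P.inv_mult P.int_pow_neg)
    then show "inv\<^bsub>P\<^esub> a \<in> \<Gamma>'" using \<Gamma>'I[OF S.m_inv_closed] a(2) by simp
  next
    fix a b assume "a \<in> \<Gamma>'" "b \<in> \<Gamma>'"
    then obtain \<gamma> k \<delta> l where a: "a = \<gamma> \<otimes>\<^bsub>P\<^esub> (h, z) [^]\<^bsub>P\<^esub> (k::int)" "\<gamma> \<in> \<Gamma>"
      and b: "b = \<delta> \<otimes>\<^bsub>P\<^esub> (h, z) [^]\<^bsub>P\<^esub> (l::int)" "\<delta> \<in> \<Gamma>" by (auto simp: \<Gamma>'_def)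
    have "a \<otimes>\<^bsub>P\<^esub> b = (\<gamma> \<otimes>\<^bsub>P\<^esub> \<delta>) \<otimes>\<^bsub>P\<^esub> (h, z) [^]\<^bsub>P\<^esub> (k + l)"
      using a b inP hzP by (simp add: P.int_pow_mult P.m_ac)
    then show "a \<otimes>\<^bsub>P\<^esub> b \<in> \<Gamma>'" using \<Gamma>'I[OF S.m_closed] a(2) b(2) by simp
  qed
  moreover have "w = 1" if "(\<one>\<^bsub>A\<^esub>, w) \<in> \<Gamma>'" for w
  proof -
    obtain \<gamma> k where *: "(\<one>\<^bsub>A\<^esub>, w) = \<gamma> \<otimes>\<^bsub>P\<^esub> (h, z) [^]\<^bsub>P\<^esub> (k::int)" "\<gamma> \<in> \<Gamma>"
      using \<open>(\<one>\<^bsub>A\<^esub>, w) \<in> \<Gamma>'\<close> by (auto simp: \<Gamma>'_def)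
    have "fst ((h, z) [^]\<^bsub>P\<^esub> k) = h [^]\<^bsub>A\<^esub> k"
      using f.hom_int_pow[OF hzP] by simp
    then have "\<one>\<^bsub>A\<^esub> = fst \<gamma> \<otimes>\<^bsub>A\<^esub> h [^]\<^bsub>A\<^esub> k"
      using arg_cong[OF *(1), of fst] f.hom_mult[OF inP[OF *(2)] P.int_pow_closed[OF hzP]] by simp
    then have "h [^]\<^bsub>A\<^esub> k = inv\<^bsub>A\<^esub> (fst \<gamma>)"
      using h(1) f.hom_closed[OF inP[OF *(2)]] by (metis A.int_pow_closed A.inv_comm A.inv_equality)
    then have "h [^]\<^bsub>A\<^esub> k \<in> fst ` \<Gamma>"
      using subgroup.m_inv_closed[OF dom] *(2) by simp
    then have "(\<one>\<^bsub>A\<^esub>, w) \<in> \<Gamma>" using zk * by simp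
    then show ?thesis using \<Gamma> by (simp add: partial_character_def)
  qed
  ultimately have "partial_character A \<Gamma>'" by (simp add: partial_character_def P_def)
  moreover have "\<gamma> \<in> \<Gamma>'" if "\<gamma> \<in> \<Gamma>" for \<gamma>
    using \<Gamma>'I[OF that, of 0] inP[OF that] by simp
  moreover have "(h, z) \<in> \<Gamma>'"
    using \<Gamma>'I[OF S.one_closed, of 1] hzP by simp
  ultimately show thesis using that z(2) by blast
qed

text \<open>Characters are made undefined outside the carrier, so that equal characters are equal functions and
  a finite group has finitely many.\<close>

definition characters :: "('a, 'r) monoid_scheme \<Rightarrow> ('a \<Rightarrow> complex) set" where
  "characters A = hom A complex_units \<inter> extensional (carrier A)"

text \<open>The trivial partial character extends to one with a value other than 1 at \<open>x\<close>.  By Zorn's lemma it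
  is contained in a maximal one, and a maximal partial character is defined everywhere because any
  missing element could be adjoined.\<close>

lemma characters_separate_points:
  assumes A: "comm_group A" and x: "x \<in> carrier A" "x \<noteq> \<one>\<^bsub>A\<^esub>"
  obtains \<chi> where "\<chi> \<in> characters A" "\<chi> x \<noteq> 1"
proof -
  interpret A: comm_group A by fact
  define P where "P = A \<times>\<times> complex_units"
  interpret P: group P
    unfolding P_def by (simp add: DirProd_group A.is_group)
  have "partial_character A {\<one>\<^bsub>P\<^esub>}"
    using P.triv_subgroup by (auto simp: partial_character_def P_def)
  moreover have "x \<notin> fst ` {\<one>\<^bsub>P\<^esub>}" using x by (simp add: P_def)
  ultimately obtain \<Gamma>0 z where \<Gamma>0: "partial_character A \<Gamma>0" "(x, z) \<in> \<Gamma>0" and z: "z \<noteq> 1"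
    using partial_character_extension[OF A _ x(1)] by metis
  define \<G> where "\<G> = {\<Gamma>. partial_character A \<Gamma> \<and> (x, z) \<in> \<Gamma>}"
  have "\<exists>\<Gamma>\<in>\<G>. \<forall>\<Gamma>'\<in>\<G>. \<Gamma> \<subseteq> \<Gamma>' \<longrightarrow> \<Gamma>' = \<Gamma>"
  proof (rule subset_Zorn_nonempty)
    show "\<G> \<noteq> {}" using \<Gamma>0 by (auto simp: \<G>_def)
    fix \<C> assume ne: "\<C> \<noteq> {}" and chain: "subset.chain \<G> \<C>"
    have mem: "\<And>\<Gamma>. \<Gamma> \<in> \<C> \<Longrightarrow> partial_character A \<Gamma> \<and> (x, z) \<in> \<Gamma>"
      using chain by (auto simp: subset.chain_def \<G>_def)
    have sub: "\<And>\<Gamma>. \<Gamma> \<in> \<C> \<Longrightarrow> subgroup \<Gamma> P" using mem by (simp add: partial_character_def P_def)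
    have "subgroup (\<Union>\<C>) P"
    proof (rule P.subgroupI)
      show "\<Union>\<C> \<subseteq> carrier P" by (intro Union_least subgroup.subset sub)
      show "\<Union>\<C> \<noteq> {}" using ne mem by auto
      show "inv\<^bsub>P\<^esub> a \<in> \<Union>\<C>" if a: "a \<in> \<Union>\<C>" for a
      proof -
        obtain \<Gamma> where "\<Gamma> \<in> \<C>" "a \<in> \<Gamma>" using a by blast
        then show ?thesis using subgroup.m_inv_closed[OF sub] by (metis UnionI)
      qed
      show "a \<otimes>\<^bsub>P\<^esub> b \<in> \<Union>\<C>" if ab: "a \<in> \<Union>\<C>" "b \<in> \<Union>\<C>" for a b
      proof -
        obtain \<Gamma> \<Delta> where \<Gamma>: "\<Gamma> \<in> \<C>" "a \<in> \<Gamma>" and \<Delta>: "\<Delta> \<in> \<C>" "b \<in> \<Delta>"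
          using ab by blast
        have "\<Gamma> \<subseteq> \<Delta> \<or> \<Delta> \<subseteq> \<Gamma>" using chain \<Gamma>(1) \<Delta>(1) by (auto simp: subset_chain_def)
        then obtain \<Theta> where "\<Theta> \<in> \<C>" "a \<in> \<Theta>" "b \<in> \<Theta>" using \<Gamma> \<Delta> by blast
        then show ?thesis using subgroup.m_closed[OF sub] by (metis UnionI)
      qed
    qed
    then have "partial_character A (\<Union>\<C>)"
      using mem by (auto simp: partial_character_def P_def)
    then show "\<Union>\<C> \<in> \<G>" using ne mem by (auto simp: \<G>_def)
  qed
  then obtain \<Gamma> where \<Gamma>: "partial_character A \<Gamma>" "(x, z) \<in> \<Gamma>"
    and max: "\<And>\<Gamma>'. partial_character A \<Gamma>' \<Longrightarrow> \<Gamma> \<subseteq> \<Gamma>' \<Longrightarrow> \<Gamma>' = \<Gamma>"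
    by (auto simp: \<G>_def)
  have sub: "subgroup \<Gamma> P" using \<Gamma> by (simp add: partial_character_def P_def)
  interpret S: subgroup \<Gamma> P by fact
  have total: "h \<in> fst ` \<Gamma>" if hA: "h \<in> carrier A" for h
  proof (rule ccontr)
    assume h: "h \<notin> fst ` \<Gamma>"
    obtain \<Gamma>' w where "partial_character A \<Gamma>'" "\<Gamma> \<subseteq> \<Gamma>'" "(h, w) \<in> \<Gamma>'"
      using partial_character_extension[OF A \<Gamma>(1) hA h] by metis
    then show False using max h by force
  qed
  have functional: "v = w" if "(a, v) \<in> \<Gamma>" "(a, w) \<in> \<Gamma>" for a v w
  proof -
    have a: "a \<in> carrier A" "v \<noteq> 0" "w \<noteq> 0" using that S.subset by (auto simp: P_def)
    have "(a, v) \<otimes>\<^bsub>P\<^esub> inv\<^bsub>P\<^esub> (a, w) \<in> \<Gamma>" using that by blast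
    moreover have "(a, v) \<otimes>\<^bsub>P\<^esub> inv\<^bsub>P\<^esub> (a, w) = (\<one>\<^bsub>A\<^esub>, v * inverse w)"
      using a by (simp add: P_def inv_DirProd A.is_group)
    ultimately show ?thesis
      using \<Gamma>(1) a by (auto simp: partial_character_def field_simps)
  qed
  define \<chi> where "\<chi> = (\<lambda>a\<in>carrier A. SOME w. (a, w) \<in> \<Gamma>)"
  have graph: "(a, \<chi> a) \<in> \<Gamma>" if a: "a \<in> carrier A" for a
    using total[OF a] a by (auto simp: \<chi>_def intro: someI)
  have "\<chi> \<in> hom A complex_units"
  proof (rule homI)
    show "\<chi> a \<in> carrier complex_units" if "a \<in> carrier A" for a
      using graph[OF that] S.subset by (auto simp: P_def)
    show "\<chi> (a \<otimes>\<^bsub>A\<^esub> b) = \<chi> a \<otimes>\<^bsub>complex_units\<^esub> \<chi> b"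
      if "a \<in> carrier A" "b \<in> carrier A" for a b
      using S.m_closed[OF graph[OF that(1)] graph[OF that(2)]] graph[of "a \<otimes>\<^bsub>A\<^esub> b"] that functional
      by (auto simp: P_def)
  qed
  then have "\<chi> \<in> characters A" by (auto simp: characters_def \<chi>_def)
  moreover have "\<chi> x = z" using graph[OF x(1)] \<Gamma>(2) functional by blast
  ultimately show thesis using that z by blast
qed

lemma character_mult: "\<chi> \<in> characters A \<Longrightarrow> a \<in> carrier A \<Longrightarrow> b \<in> carrier A \<Longrightarrow> \<chi> (a \<otimes>\<^bsub>A\<^esub> b) = \<chi> a * \<chi> b"
  by (auto simp: characters_def hom_def)

lemma character_nonzero: "\<chi> \<in> characters A \<Longrightarrow> a \<in> carrier A \<Longrightarrow> \<chi> a \<noteq> 0"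
  by (auto simp: characters_def hom_def)

lemma character_one: "group A \<Longrightarrow> \<chi> \<in> characters A \<Longrightarrow> \<chi> \<one>\<^bsub>A\<^esub> = 1"
  using hom_one[of \<chi> A complex_units] by (auto simp: characters_def)

lemma finite_characters:
  assumes "group A" "finite (carrier A)"
  shows "finite (characters A)"
proof -
  interpret group A by fact
  define m where "m = order A"
  have "m > 0" using assms(2) by (simp add: m_def order_gt_0_iff_finite)
  have "finite {z::complex. z ^ m = 1}"
    using finite_nth_roots[of m 1] \<open>m > 0\<close> by simp
  moreover have "characters A \<subseteq> carrier A \<rightarrow>\<^sub>E {z. z ^ m = 1}"
  proof
    fix \<chi> assume \<chi>: "\<chi> \<in> characters A"
    have "\<chi> a ^ m = 1" if a: "a \<in> carrier A" for a
    proof -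
      interpret \<chi>: group_hom A complex_units \<chi>
        using \<chi> by (simp add: group_hom_def group_hom_axioms_def characters_def is_group)
      have "\<chi> a ^ m = \<chi> (a [^]\<^bsub>A\<^esub> m)"
        using \<chi>.hom_nat_pow[OF a, of m] by simp
      then show ?thesis using pow_order_eq_1[OF a] \<chi>.hom_one by (simp add: m_def)
    qed
    then show "\<chi> \<in> carrier A \<rightarrow>\<^sub>E {z. z ^ m = 1}"
      using \<chi> by (auto simp: characters_def extensional_def)
  qed
  ultimately show ?thesis
    using assms(2) by (meson finite_PiE finite_subset)
qed

text \<open>Evaluate the sum of all \<open>\<chi> a\<close> in two ways.  Translating by an element where \<open>\<chi>\<close> is not 1 shows that
  a nontrivial \<open>\<chi>\<close> contributes 0, which leaves \<open>|A|\<close>.  Multiplying by a character that is not 1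
  at \<open>a\<close> shows that \<open>a \<noteq> 1\<close> contributes 0, which leaves the number of characters.\<close>

lemma card_characters:
  assumes A: "comm_group A" and fin: "finite (carrier A)"
  shows "card (characters A) = card (carrier A)"
proof -
  interpret A: comm_group A by fact
  let ?X = "characters A" and ?u = "\<lambda>a\<in>carrier A. 1::complex"
  have finX: "finite ?X" using finite_characters A.is_group fin .
  have triv: "?u \<in> ?X" by (auto simp: characters_def hom_def)
  have row: "(\<Sum>a\<in>carrier A. \<chi> a) = (if \<chi> = ?u then of_nat (card (carrier A)) else 0)"
    if \<chi>: "\<chi> \<in> ?X" for \<chi>
  proof (cases "\<chi> = ?u")
    case False
    then obtain b where b: "b \<in> carrier A" "\<chi> b \<noteq> 1"
      using \<chi> by (auto simp: characters_def fun_eq_iff extensional_def restrict_def split: if_splits)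
    have "bij_betw (\<lambda>a. b \<otimes>\<^bsub>A\<^esub> a) (carrier A) (carrier A)"
      using b(1) by (intro bij_betwI[where g = "\<lambda>a. inv\<^bsub>A\<^esub> b \<otimes>\<^bsub>A\<^esub> a"]) (auto simp: A.m_assoc[symmetric])
    from sum.reindex_bij_betw[OF this, of \<chi>]
    have "(\<Sum>a\<in>carrier A. \<chi> a) = (\<Sum>a\<in>carrier A. \<chi> (b \<otimes>\<^bsub>A\<^esub> a))" by simp
    also have "\<dots> = \<chi> b * (\<Sum>a\<in>carrier A. \<chi> a)"
      using b \<chi> by (simp add: sum_distrib_left character_mult)
    finally show ?thesis using b(2) False by simp
  qed simp
  have col: "(\<Sum>\<chi>\<in>?X. \<chi> a) = (if a = \<one>\<^bsub>A\<^esub> then of_nat (card ?X) else 0)"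
    if a: "a \<in> carrier A" for a
  proof (cases "a = \<one>\<^bsub>A\<^esub>")
    case True
    then show ?thesis by (simp add: character_one A.is_group)
  next
    case False
    obtain \<psi> where \<psi>: "\<psi> \<in> ?X" "\<psi> a \<noteq> 1"
      using characters_separate_points[OF A a False] .
    have "bij_betw (\<lambda>\<chi>. \<lambda>a\<in>carrier A. \<psi> a * \<chi> a) ?X ?X"
    proof (rule bij_betwI[where g = "\<lambda>\<chi>. \<lambda>a\<in>carrier A. inverse (\<psi> a) * \<chi> a"])
      show "(\<lambda>\<chi>. \<lambda>a\<in>carrier A. \<psi> a * \<chi> a) \<in> ?X \<rightarrow> ?X"
        using \<psi>(1) by (auto simp: characters_def hom_def Pi_iff)
      show "(\<lambda>\<chi>. \<lambda>a\<in>carrier A. inverse (\<psi> a) * \<chi> a) \<in> ?X \<rightarrow> ?X"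
        using \<psi>(1) by (auto simp: characters_def hom_def Pi_iff)
    qed (use character_nonzero[OF \<psi>(1)] in \<open>auto simp: fun_eq_iff characters_def extensional_def\<close>)
    from sum.reindex_bij_betw[OF this, of "\<lambda>\<chi>. \<chi> a"]
    have "(\<Sum>\<chi>\<in>?X. \<chi> a) = (\<Sum>\<chi>\<in>?X. \<psi> a * \<chi> a)" using a by simp
    also have "\<dots> = \<psi> a * (\<Sum>\<chi>\<in>?X. \<chi> a)" by (simp add: sum_distrib_left)
    finally show ?thesis using \<psi>(2) False by simp
  qed
  have "of_nat (card ?X) = (\<Sum>a\<in>carrier A. \<Sum>\<chi>\<in>?X. \<chi> a)"
    using fin by (simp add: col sum.delta)
  also have "\<dots> = (\<Sum>\<chi>\<in>?X. \<Sum>a\<in>carrier A. \<chi> a)" by (rule sum.swap)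
  also have "\<dots> = of_nat (card (carrier A))"
    using finX triv by (simp add: row sum.delta)
  finally show ?thesis using of_nat_eq_iff by blast
qed

section \<open>The Schur multiplier\<close>

abbreviation cohomology_class :: "('a, 'r) monoid_scheme \<Rightarrow> ('a \<times> 'a \<Rightarrow> complex) \<Rightarrow> ('a \<times> 'a \<Rightarrow> complex) set" where
  "cohomology_class G f \<equiv> coboundaries2 G complex_units #>\<^bsub>cochains2 G complex_units\<^esub> f"

lemma carrier_schur_multiplier:
  "carrier (schur_multiplier G) = cohomology_class G ` cocycles2 G complex_units"
  by (auto simp: schur_multiplier_def cohomology2_def FactGroup_def RCOSETS_def r_coset_def)

lemma group_cochains2: "group (cochains2 G complex_units)"
  by (simp add: cochains2_def)

lemma cocycles2_complex_units_iff:
  "f \<in> cocycles2 G complex_units \<longleftrightarrow>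
     f \<in> carrier G \<times> carrier G \<rightarrow>\<^sub>E UNIV - {0} \<and>
     (\<forall>g\<in>carrier G. \<forall>h\<in>carrier G. \<forall>k\<in>carrier G.
        f (h, k) * f (g, h \<otimes>\<^bsub>G\<^esub> k) = f (g \<otimes>\<^bsub>G\<^esub> h, k) * f (g, h))"
  by (simp add: cocycles2_def cochains2_def)

lemma coboundaries2_complex_units_iff:
  assumes "group G"
  shows "f \<in> coboundaries2 G complex_units \<longleftrightarrow>
     f \<in> extensional (carrier G \<times> carrier G) \<and>
     (\<exists>c. (\<forall>g\<in>carrier G. c g \<noteq> 0) \<and>
       (\<forall>g\<in>carrier G. \<forall>h\<in>carrier G. f (g, h) = c h * inverse (c (g \<otimes>\<^bsub>G\<^esub> h)) * c g))"
    (is "?L \<longleftrightarrow> ?R")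
proof -
  interpret group G by fact
  show ?thesis
  proof
    assume ?L
    then obtain c where c: "c \<in> carrier G \<rightarrow> UNIV - {0}"
      and fc: "\<forall>g\<in>carrier G. \<forall>h\<in>carrier G. f (g, h) =
         c h \<otimes>\<^bsub>complex_units\<^esub> inv\<^bsub>complex_units\<^esub> c (g \<otimes>\<^bsub>G\<^esub> h) \<otimes>\<^bsub>complex_units\<^esub> c g"
      and ext: "f \<in> extensional (carrier G \<times> carrier G)"
      unfolding coboundaries2_def cochains2_def by (simp add: PiE_iff extensional_def) blast
    have "c g \<noteq> 0" if "g \<in> carrier G" for g using c that by auto
    then show ?R using fc ext by (intro conjI exI[of _ c]) auto
  next
    assume ?R
    then obtain c where c: "\<And>g. g \<in> carrier G \<Longrightarrow> c g \<noteq> 0"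
      and fc: "\<And>g h. g \<in> carrier G \<Longrightarrow> h \<in> carrier G \<Longrightarrow>
         f (g, h) = c h * inverse (c (g \<otimes>\<^bsub>G\<^esub> h)) * c g"
      and ext: "f \<in> extensional (carrier G \<times> carrier G)" by auto
    show ?L
      unfolding coboundaries2_def cochains2_def
      using c fc ext by (auto intro!: bexI[of _ c] simp: extensional_def)
  qed
qed

lemma subgroup_coboundaries2:
  assumes "group G"
  shows "subgroup (coboundaries2 G complex_units) (cochains2 G complex_units)"
proof -
  interpret G: group G by fact
  interpret C: group "cochains2 G complex_units" by (rule group_cochains2)
  note iff = coboundaries2_complex_units_iff[OF assms]
  have inC: "f \<in> carrier G \<times> carrier G \<rightarrow>\<^sub>E UNIV - {0}" if "f \<in> coboundaries2 G complex_units" for f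
    using that by (simp add: coboundaries2_def cochains2_def)
  show ?thesis
  proof (rule C.subgroupI)
    show "coboundaries2 G complex_units \<subseteq> carrier (cochains2 G complex_units)"
      by (auto simp: coboundaries2_def)
    have "(\<lambda>_\<in>carrier G \<times> carrier G. 1) \<in> coboundaries2 G complex_units"
      unfolding iff by (auto intro!: exI[of _ "\<lambda>_. 1"])
    then show "coboundaries2 G complex_units \<noteq> {}" by blast
  next
    fix f assume f: "f \<in> coboundaries2 G complex_units"
    then obtain c where "\<forall>g\<in>carrier G. c g \<noteq> 0"
      "\<forall>g\<in>carrier G. \<forall>h\<in>carrier G. f (g, h) = c h * inverse (c (g \<otimes>\<^bsub>G\<^esub> h)) * c g"
      unfolding iff by blast
    moreover have "inv\<^bsub>cochains2 G complex_units\<^esub> f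
        = (\<lambda>x\<in>carrier G \<times> carrier G. inverse (f x))"
      using inC[OF f] unfolding cochains2_def
      by (subst inv_product_group) (auto simp: fun_eq_iff PiE_iff intro!: inv_complex_units)
    ultimately show "inv\<^bsub>cochains2 G complex_units\<^esub> f \<in> coboundaries2 G complex_units"
      unfolding iff by (auto intro!: exI[of _ "\<lambda>g. inverse (c g)"])
  next
    fix f f' assume f: "f \<in> coboundaries2 G complex_units" "f' \<in> coboundaries2 G complex_units"
    then obtain c c' where "\<forall>g\<in>carrier G. c g \<noteq> 0" "\<forall>g\<in>carrier G. c' g \<noteq> 0"
      "\<forall>g\<in>carrier G. \<forall>h\<in>carrier G. f (g, h) = c h * inverse (c (g \<otimes>\<^bsub>G\<^esub> h)) * c g"
      "\<forall>g\<in>carrier G. \<forall>h\<in>carrier G. f' (g, h) = c' h * inverse (c' (g \<otimes>\<^bsub>G\<^esub> h)) * c' g"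
      unfolding iff by blast
    then show "f \<otimes>\<^bsub>cochains2 G complex_units\<^esub> f' \<in> coboundaries2 G complex_units"
      unfolding iff cochains2_def by (auto intro!: exI[of _ "\<lambda>g. c g * c' g"])
  qed
qed

text \<open>With \<open>c(g) = \<Prod>\<^sub>k f(g, k)\<close> and \<open>m = |G|\<close>, the product of the cocycle identities over \<open>k\<close> says that
  \<open>f\<^sup>m\<close> is the coboundary of \<open>c\<close>.  Dividing \<open>f\<close> by the coboundary of an \<open>m\<close>-th root of \<open>c\<close> leaves a
  cohomologous function with values in the \<open>m\<close>-th roots of unity, and there are only finitely many
  of these.\<close>

lemma finite_schur_multiplier:
  assumes "group G" and fin: "finite (carrier G)"
  shows "finite (carrier (schur_multiplier G))"
proof -
  interpret G: group G by fact
  define m where "m = card (carrier G)"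
  have m: "m > 0" using fin G.one_closed by (auto simp: m_def card_gt_0_iff)
  let ?T = "carrier G \<times> carrier G \<rightarrow>\<^sub>E {z::complex. z ^ m = 1}"
  have "\<exists>f'\<in>?T. cohomology_class G f = cohomology_class G f'"
    if f: "f \<in> cocycles2 G complex_units" for f
  proof -
    have f0: "f (g, h) \<noteq> 0" if "g \<in> carrier G" "h \<in> carrier G" for g h
      using f that by (auto simp: cocycles2_complex_units_iff)
    have cocycle: "f (h, k) * f (g, h \<otimes>\<^bsub>G\<^esub> k) = f (g \<otimes>\<^bsub>G\<^esub> h, k) * f (g, h)"
      if "g \<in> carrier G" "h \<in> carrier G" "k \<in> carrier G" for g h k
      using f that by (auto simp: cocycles2_complex_units_iff)
    define c where "c g = (\<Prod>k\<in>carrier G. f (g, k))" for g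
    have c0: "c g \<noteq> 0" if "g \<in> carrier G" for g
      using fin f0 that by (simp add: c_def)
    have power: "f (g, h) ^ m = c h * c g / c (g \<otimes>\<^bsub>G\<^esub> h)" if g: "g \<in> carrier G" and h: "h \<in> carrier G" for g h
    proof -
      have "bij_betw (\<lambda>k. h \<otimes>\<^bsub>G\<^esub> k) (carrier G) (carrier G)"
        using h by (intro bij_betwI[where g = "\<lambda>k. inv\<^bsub>G\<^esub> h \<otimes>\<^bsub>G\<^esub> k"]) (auto simp: G.m_assoc[symmetric])
      from prod.reindex_bij_betw[OF this, of "\<lambda>k. f (g, k)"]
      have "c h * c g = (\<Prod>k\<in>carrier G. f (h, k) * f (g, h \<otimes>\<^bsub>G\<^esub> k))"
        by (simp add: c_def prod.distrib)
      also have "\<dots> = (\<Prod>k\<in>carrier G. f (g \<otimes>\<^bsub>G\<^esub> h, k) * f (g, h))"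
        using cocycle g h by (intro prod.cong) auto
      also have "\<dots> = c (g \<otimes>\<^bsub>G\<^esub> h) * f (g, h) ^ m"
        by (simp add: c_def prod.distrib m_def)
      finally show ?thesis using c0 g h by (simp add: field_simps)
    qed
    have "\<forall>g\<in>carrier G. \<exists>d. d ^ m = inverse (c g)"
    proof
      fix g assume "g \<in> carrier G"
      then have "card {z. z ^ m = inverse (c g)} = m"
        using card_nth_roots[of "inverse (c g)" m] c0 m by simp
      then have "{z. z ^ m = inverse (c g)} \<noteq> {}" using m by force
      then show "\<exists>d. d ^ m = inverse (c g)" by blast
    qed
    then obtain d where d: "\<And>g. g \<in> carrier G \<Longrightarrow> d g ^ m = inverse (c g)" by metis
    have d0: "d g \<noteq> 0" if "g \<in> carrier G" for g
      using d[OF that] c0[OF that] m by (metis zero_power inverse_zero_imp_zero)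
    define b where "b = (\<lambda>(g, h)\<in>carrier G \<times> carrier G. d h * inverse (d (g \<otimes>\<^bsub>G\<^esub> h)) * d g)"
    have b: "b \<in> coboundaries2 G complex_units"
      unfolding coboundaries2_complex_units_iff[OF assms(1)] b_def
      using d0 by (auto intro!: exI[of _ d])
    define f' where "f' = b \<otimes>\<^bsub>cochains2 G complex_units\<^esub> f"
    have "f' \<in> cohomology_class G f"
      using b by (auto simp: f'_def r_coset_def)
    moreover have "f \<in> carrier (cochains2 G complex_units)"
      using f by (simp add: cocycles2_def)
    ultimately have "cohomology_class G f = cohomology_class G f'"
      using group.repr_independence[OF group_cochains2 _ _ subgroup_coboundaries2[OF assms(1)]] by blast
    moreover have "f' (g, h) ^ m = 1" if "g \<in> carrier G" "h \<in> carrier G" for g h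
    proof -
      have "f' (g, h) ^ m = (d h ^ m * inverse (d (g \<otimes>\<^bsub>G\<^esub> h) ^ m) * d g ^ m) * f (g, h) ^ m"
        using that by (simp add: f'_def b_def cochains2_def power_mult_distrib power_inverse)
      then have "f' (g, h) ^ m = inverse (c h) * c (g \<otimes>\<^bsub>G\<^esub> h) * inverse (c g) * (c h * c g / c (g \<otimes>\<^bsub>G\<^esub> h))"
        using that by (simp add: d power)
      then show ?thesis using that c0[of g] c0[of h] c0[of "g \<otimes>\<^bsub>G\<^esub> h"] by (simp add: field_simps)
    qed
    moreover have "f' \<in> extensional (carrier G \<times> carrier G)"
      by (auto simp: f'_def cochains2_def)
    ultimately show ?thesis by (intro bexI[of _ f']) (auto simp: PiE_iff)
  qed
  then have "carrier (schur_multiplier G) \<subseteq> cohomology_class G ` ?T"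
    by (auto simp: carrier_schur_multiplier) (metis image_eqI)
  moreover have "finite ?T"
    using fin finite_nth_roots[of m "1::complex"] m by (auto intro: finite_PiE)
  ultimately show ?thesis by (meson finite_imageI finite_subset)
qed

text \<open>Choose a section \<open>s\<close> of \<open>\<theta>\<close> and write \<open>u = r(u) s(\<theta> u)\<close> with \<open>r(u)\<close> in the kernel.  Centrality gives
  \<open>r(uv) = r(u) r(v) r(s(\<theta> u) s(\<theta> v))\<close>, so a character \<open>\<chi>\<close> of the kernel yields the 2-cocycle
  \<open>\<chi>(r(s(g) s(h)))\<close>; the cocycle identity is associativity in \<open>U\<close>.  If the cocycles of \<open>\<chi>\<close> and \<open>\<psi>\<close>
  differ by the coboundary of \<open>c\<close>, then \<open>\<chi>(r(u)) \<psi>(r(u))\<^sup>-\<^sup>1 c(\<theta> u)\<close> is a homomorphism on \<open>U\<close>, hence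
  trivial, and this forces \<open>\<chi> = \<psi>\<close>.\<close>

lemma kernel_characters_embed:
  assumes U: "group U" and G: "group G" and fin: "finite (carrier G)"
    and \<theta>: "\<theta> \<in> epi U G"
    and central: "\<And>r u. r \<in> kernel U G \<theta> \<Longrightarrow> u \<in> carrier U \<Longrightarrow> r \<otimes>\<^bsub>U\<^esub> u = u \<otimes>\<^bsub>U\<^esub> r"
    and no_chars: "\<And>\<kappa> u. \<kappa> \<in> hom U complex_units \<Longrightarrow> u \<in> carrier U \<Longrightarrow> \<kappa> u = 1"
  defines "Ch \<equiv> characters (U\<lparr>carrier := kernel U G \<theta>\<rparr>)"
  shows "finite Ch" "card Ch \<le> card (carrier (schur_multiplier G))"
proof -
  interpret U: group U by fact
  interpret G: group G by fact
  interpret \<theta>: group_hom U G \<theta>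
    using U G \<theta> by (simp add: group_hom_def group_hom_axioms_def epi_def)
  define R where "R = kernel U G \<theta>"
  have R_iff: "u \<in> R \<longleftrightarrow> u \<in> carrier U \<and> \<theta> u = \<one>\<^bsub>G\<^esub>" for u by (simp add: R_def kernel_def)
  have sR: "subgroup R U" unfolding R_def by (rule \<theta>.subgroup_kernel)
  interpret R: subgroup R U by fact
  have "\<forall>g\<in>carrier G. \<exists>u\<in>carrier U. \<theta> u = g" using \<theta> unfolding epi_def by (metis (mono_tags, lifting) imageE mem_Collect_eq)
  then obtain s where s: "\<And>g. g \<in> carrier G \<Longrightarrow> s g \<in> carrier U \<and> \<theta> (s g) = g" by metis
  have sU: "\<And>g. g \<in> carrier G \<Longrightarrow> s g \<in> carrier U" using s by blast
  define r where "r u = u \<otimes>\<^bsub>U\<^esub> inv\<^bsub>U\<^esub> s (\<theta> u)" for u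
  have rR: "r u \<in> R" if "u \<in> carrier U" for u
  proof -
    have "s (\<theta> u) \<in> carrier U" "\<theta> (s (\<theta> u)) = \<theta> u" using s[OF \<theta>.hom_closed[OF that]] by auto
    then show ?thesis unfolding R_iff using that by (simp add: r_def)
  qed
  have rU: "r u \<in> carrier U" if "u \<in> carrier U" for u by (rule R.mem_carrier[OF rR[OF that]])
  have r_dec: "r u \<otimes>\<^bsub>U\<^esub> s (\<theta> u) = u" if "u \<in> carrier U" for u
    using that sU[OF \<theta>.hom_closed[OF that]] by (simp add: r_def U.m_assoc)
  have r_section: "r (s g) = \<one>\<^bsub>U\<^esub>" if "g \<in> carrier G" for g
    using s[OF that] by (simp add: r_def)
  have r_eqI: "r u = a" if "u \<in> carrier U" "a \<in> R" "a \<otimes>\<^bsub>U\<^esub> s (\<theta> u) = u" for u a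
    using that r_dec[OF that(1)] rU[OF that(1)] R.subset sU[OF \<theta>.hom_closed[OF that(1)]]
    by (metis U.r_cancel subsetD)
  have r_mult: "r (u \<otimes>\<^bsub>U\<^esub> v) = r u \<otimes>\<^bsub>U\<^esub> r v \<otimes>\<^bsub>U\<^esub> r (s (\<theta> u) \<otimes>\<^bsub>U\<^esub> s (\<theta> v))"
    if u: "u \<in> carrier U" and v: "v \<in> carrier U" for u v
  proof (rule r_eqI)
    let ?g = "\<theta> u" and ?h = "\<theta> v"
    have gh: "?g \<in> carrier G" "?h \<in> carrier G" using u v by auto
    let ?e = "r (s ?g \<otimes>\<^bsub>U\<^esub> s ?h)"
    have sgh: "s ?g \<in> carrier U" "s ?h \<in> carrier U" "s (?g \<otimes>\<^bsub>G\<^esub> ?h) \<in> carrier U"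
      using gh s by auto
    show "r u \<otimes>\<^bsub>U\<^esub> r v \<otimes>\<^bsub>U\<^esub> ?e \<in> R" using rR u v sgh by simp
    have e: "?e \<otimes>\<^bsub>U\<^esub> s (?g \<otimes>\<^bsub>G\<^esub> ?h) = s ?g \<otimes>\<^bsub>U\<^esub> s ?h"
      using r_dec[of "s ?g \<otimes>\<^bsub>U\<^esub> s ?h"] sgh s gh by simp
    have "u \<otimes>\<^bsub>U\<^esub> v = (r u \<otimes>\<^bsub>U\<^esub> s ?g) \<otimes>\<^bsub>U\<^esub> (r v \<otimes>\<^bsub>U\<^esub> s ?h)"
      using r_dec u v by simp
    also have "\<dots> = r u \<otimes>\<^bsub>U\<^esub> (s ?g \<otimes>\<^bsub>U\<^esub> r v) \<otimes>\<^bsub>U\<^esub> s ?h"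
      using rU u v sgh by (simp add: U.m_assoc)
    also have "s ?g \<otimes>\<^bsub>U\<^esub> r v = r v \<otimes>\<^bsub>U\<^esub> s ?g"
      using central[OF _ sgh(1)] rR[OF v] by (simp add: R_def)
    also have "r u \<otimes>\<^bsub>U\<^esub> (r v \<otimes>\<^bsub>U\<^esub> s ?g) \<otimes>\<^bsub>U\<^esub> s ?h = r u \<otimes>\<^bsub>U\<^esub> r v \<otimes>\<^bsub>U\<^esub> (s ?g \<otimes>\<^bsub>U\<^esub> s ?h)"
      using rU u v sgh by (simp add: U.m_assoc)
    also have "\<dots> = r u \<otimes>\<^bsub>U\<^esub> r v \<otimes>\<^bsub>U\<^esub> (?e \<otimes>\<^bsub>U\<^esub> s (?g \<otimes>\<^bsub>G\<^esub> ?h))"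
      by (simp only: e)
    also have "\<dots> = r u \<otimes>\<^bsub>U\<^esub> r v \<otimes>\<^bsub>U\<^esub> ?e \<otimes>\<^bsub>U\<^esub> s (\<theta> (u \<otimes>\<^bsub>U\<^esub> v))"
      using rU[OF u] rU[OF v] rU[OF U.m_closed[OF sgh(1,2)]] sgh(3) u v by (simp add: U.m_assoc)
    finally show "r u \<otimes>\<^bsub>U\<^esub> r v \<otimes>\<^bsub>U\<^esub> ?e \<otimes>\<^bsub>U\<^esub> s (\<theta> (u \<otimes>\<^bsub>U\<^esub> v)) = u \<otimes>\<^bsub>U\<^esub> v" by simp
  qed (use u v in auto)
  have chi_mult: "\<chi> (a \<otimes>\<^bsub>U\<^esub> b) = \<chi> a * \<chi> b" if "\<chi> \<in> Ch" "a \<in> R" "b \<in> R" for \<chi> a b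
    using character_mult[of \<chi> "U\<lparr>carrier := R\<rparr>" a b] that by (simp add: Ch_def R_def)
  have chi0: "\<chi> a \<noteq> 0" if "\<chi> \<in> Ch" "a \<in> R" for \<chi> a
    using character_nonzero[of \<chi> "U\<lparr>carrier := R\<rparr>" a] that by (simp add: Ch_def R_def)
  have chi1: "\<chi> \<one>\<^bsub>U\<^esub> = 1" if "\<chi> \<in> Ch" for \<chi>
    using chi_mult[OF that, of "\<one>\<^bsub>U\<^esub>" "\<one>\<^bsub>U\<^esub>"] chi0[OF that, of "\<one>\<^bsub>U\<^esub>"] by simp
  have chi_r_mult: "\<chi> (r (u \<otimes>\<^bsub>U\<^esub> v)) = \<chi> (r u) * \<chi> (r v) * \<chi> (r (s (\<theta> u) \<otimes>\<^bsub>U\<^esub> s (\<theta> v)))"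
    if "\<chi> \<in> Ch" "u \<in> carrier U" "v \<in> carrier U" for \<chi> u v
    unfolding r_mult[OF that(2,3)] using that rR sU by (simp add: chi_mult)
  define ob where "ob \<chi> = (\<lambda>(g, h)\<in>carrier G \<times> carrier G. \<chi> (r (s g \<otimes>\<^bsub>U\<^esub> s h)))" for \<chi> :: "'a \<Rightarrow> complex"
  have ob_cocycle: "ob \<chi> \<in> cocycles2 G complex_units" if \<chi>: "\<chi> \<in> Ch" for \<chi>
  proof -
    have "\<chi> (r (s h \<otimes>\<^bsub>U\<^esub> s k)) * \<chi> (r (s g \<otimes>\<^bsub>U\<^esub> s (h \<otimes>\<^bsub>G\<^esub> k))) =
        \<chi> (r (s (g \<otimes>\<^bsub>G\<^esub> h) \<otimes>\<^bsub>U\<^esub> s k)) * \<chi> (r (s g \<otimes>\<^bsub>U\<^esub> s h))"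
      if g: "g \<in> carrier G" and h: "h \<in> carrier G" and k: "k \<in> carrier G" for g h k
      using chi_r_mult[OF \<chi>, of "s g \<otimes>\<^bsub>U\<^esub> s h" "s k"] chi_r_mult[OF \<chi>, of "s g" "s h \<otimes>\<^bsub>U\<^esub> s k"]
        s g h k by (simp add: U.m_assoc r_section chi1[OF \<chi>] mult.commute)
    then show ?thesis
      using chi0[OF \<chi>] rR sU by (auto simp: ob_def cocycles2_complex_units_iff)
  qed
  have "inj_on (\<lambda>\<chi>. cohomology_class G (ob \<chi>)) Ch"
  proof (rule inj_onI)
    fix \<chi> \<psi> assume \<chi>: "\<chi> \<in> Ch" and \<psi>: "\<psi> \<in> Ch"
      and eq: "cohomology_class G (ob \<chi>) = cohomology_class G (ob \<psi>)"
    have "ob \<chi> \<in> cohomology_class G (ob \<chi>)"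
      using group.rcos_self[OF group_cochains2 _ subgroup_coboundaries2[OF G]] ob_cocycle[OF \<chi>]
      by (auto simp: cocycles2_def)
    then obtain b where b: "b \<in> coboundaries2 G complex_units"
      and ob_eq: "ob \<chi> = b \<otimes>\<^bsub>cochains2 G complex_units\<^esub> ob \<psi>"
      unfolding eq by (auto simp: r_coset_def)
    obtain c where c0: "\<And>g. g \<in> carrier G \<Longrightarrow> c g \<noteq> 0"
      and bc: "\<And>g h. g \<in> carrier G \<Longrightarrow> h \<in> carrier G \<Longrightarrow> b (g, h) = c h * inverse (c (g \<otimes>\<^bsub>G\<^esub> h)) * c g"
      using b unfolding coboundaries2_complex_units_iff[OF G] by blast
    have ob_rel: "\<chi> (r (s g \<otimes>\<^bsub>U\<^esub> s h)) = c h * inverse (c (g \<otimes>\<^bsub>G\<^esub> h)) * c g * \<psi> (r (s g \<otimes>\<^bsub>U\<^esub> s h))"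
      if "g \<in> carrier G" "h \<in> carrier G" for g h
      using fun_cong[OF ob_eq, of "(g, h)"] that by (simp add: ob_def cochains2_def bc)
    define \<kappa> where "\<kappa> u = \<chi> (r u) * inverse (\<psi> (r u)) * c (\<theta> u)" for u
    have "\<kappa> \<in> hom U complex_units"
    proof (rule homI)
      show "\<kappa> u \<in> carrier complex_units" if "u \<in> carrier U" for u
        using chi0[OF \<chi> rR[OF that]] chi0[OF \<psi> rR[OF that]] c0 that by (simp add: \<kappa>_def)
      fix u v assume u: "u \<in> carrier U" and v: "v \<in> carrier U"
      have "\<psi> (r (s (\<theta> u) \<otimes>\<^bsub>U\<^esub> s (\<theta> v))) \<noteq> 0" "c (\<theta> u \<otimes>\<^bsub>G\<^esub> \<theta> v) \<noteq> 0"
        using u v sU chi0[OF \<psi> rR] c0 by auto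
      then show "\<kappa> (u \<otimes>\<^bsub>U\<^esub> v) = \<kappa> u \<otimes>\<^bsub>complex_units\<^esub> \<kappa> v"
        using u v by (simp add: \<kappa>_def chi_r_mult[OF \<chi> u v] chi_r_mult[OF \<psi> u v] ob_rel field_simps)
    qed
    from no_chars[OF this]
    have triv: "\<chi> (r u) * inverse (\<psi> (r u)) * c (\<theta> u) = 1" if "u \<in> carrier U" for u
      using that by (simp add: \<kappa>_def)
    have "\<chi> a = \<psi> a" if a: "a \<in> R" for a
    proof -
      have aU: "a \<in> carrier U" and \<theta>a: "\<theta> a = \<one>\<^bsub>G\<^esub>" using a by (simp_all add: R_iff)
      \<comment> \<open>\<open>s \<one>\<close> is some element of the kernel, whence the factor \<open>r \<one>\<close>\<close>
      have "r a = a \<otimes>\<^bsub>U\<^esub> r \<one>\<^bsub>U\<^esub>"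
        using aU \<theta>a sU by (simp add: r_def)
      then have "\<chi> (r a) = \<chi> a * \<chi> (r \<one>\<^bsub>U\<^esub>)" "\<psi> (r a) = \<psi> a * \<psi> (r \<one>\<^bsub>U\<^esub>)"
        using chi_mult \<chi> \<psi> a rR by simp_all
      then show ?thesis
        using triv[OF aU] triv[OF U.one_closed] \<theta>a chi0[OF \<psi> a] chi0[OF \<psi> rR[OF U.one_closed]]
          chi0[OF \<chi> rR[OF U.one_closed]] c0[OF G.one_closed]
        by (simp add: field_simps)
    qed
    moreover have "\<chi> \<in> extensional R" "\<psi> \<in> extensional R"
      using \<chi> \<psi> by (auto simp: Ch_def characters_def R_def)
    ultimately show "\<chi> = \<psi>" by (meson extensionalityI)
  qed
  moreover have "(\<lambda>\<chi>. cohomology_class G (ob \<chi>)) ` Ch \<subseteq> carrier (schur_multiplier G)"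
    using ob_cocycle by (auto simp: carrier_schur_multiplier)
  moreover note finite_schur_multiplier[OF G fin]
  ultimately show "finite Ch" "card Ch \<le> card (carrier (schur_multiplier G))"
    by (meson inj_on_finite, meson card_inj_on_le)
qed

section \<open>Perfect central extensions mapping onto a cover\<close>

text \<open>All characters of \<open>ker \<theta>\<close> come from \<open>ker p\<close>: pulling back along \<open>\<psi>\<close> is injective, \<open>ker p\<close> has
  \<open>|H\<^sup>2(G, \<complex>\<^sup>*)|\<close> characters since it is isomorphic to the Schur multiplier, and \<open>ker \<theta>\<close> has no more than
  that.  An element of the kernel of \<open>\<psi>\<close> lies in \<open>ker \<theta>\<close> and is sent to 1 by every character pulled
  back along \<open>\<psi>\<close>, so it cannot be separated from 1.\<close>

lemma cover_surjection_injective: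
  assumes G: "group G" and fin: "finite (carrier G)" and cover: "is_cover M E G i p"
    and U: "group U" and \<theta>: "\<theta> \<in> epi U G"
    and central: "\<And>r u. r \<in> kernel U G \<theta> \<Longrightarrow> u \<in> carrier U \<Longrightarrow> r \<otimes>\<^bsub>U\<^esub> u = u \<otimes>\<^bsub>U\<^esub> r"
    and no_chars: "\<And>\<kappa> u. \<kappa> \<in> hom U complex_units \<Longrightarrow> u \<in> carrier U \<Longrightarrow> \<kappa> u = 1"
    and \<psi>: "\<psi> \<in> epi U E" and lift: "\<And>u. u \<in> carrier U \<Longrightarrow> p (\<psi> u) = \<theta> u"
  shows "inj_on \<psi> (carrier U)"
proof -
  have M: "group M" and E: "group E" and i: "i \<in> mon M E" and p: "p \<in> epi E G"
    and exact: "i ` carrier M = kernel E G p"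
    and i_central: "\<And>m e. m \<in> carrier M \<Longrightarrow> e \<in> carrier E \<Longrightarrow> i m \<otimes>\<^bsub>E\<^esub> e = e \<otimes>\<^bsub>E\<^esub> i m"
    and schur: "M \<cong> schur_multiplier G"
    using cover by (auto simp: is_cover_def central_extension_def short_exact_def)
  interpret U: group U by fact
  interpret E: group E by fact
  interpret \<theta>: group_hom U G \<theta>
    using U G \<theta> by (simp add: group_hom_def group_hom_axioms_def epi_def)
  interpret p: group_hom E G p
    using E G p by (simp add: group_hom_def group_hom_axioms_def epi_def)
  interpret \<psi>: group_hom U E \<psi>
    using U E \<psi> by (simp add: group_hom_def group_hom_axioms_def epi_def)
  define R where "R = kernel U G \<theta>"
  define K where "K = kernel E G p"
  have R_iff: "u \<in> R \<longleftrightarrow> u \<in> carrier U \<and> \<theta> u = \<one>\<^bsub>G\<^esub>" for u by (simp add: R_def kernel_def)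
  have K_iff: "e \<in> K \<longleftrightarrow> e \<in> carrier E \<and> p e = \<one>\<^bsub>G\<^esub>" for e by (simp add: K_def kernel_def)
  have sR: "subgroup R U" unfolding R_def by (rule \<theta>.subgroup_kernel)
  have sK: "subgroup K E" unfolding K_def by (rule p.subgroup_kernel)
  let ?A = "E\<lparr>carrier := K\<rparr>" and ?B = "U\<lparr>carrier := R\<rparr>"
  have "k \<otimes>\<^bsub>E\<^esub> e = e \<otimes>\<^bsub>E\<^esub> k" if "k \<in> K" "e \<in> carrier E" for k e
    using that i_central unfolding K_def exact[symmetric] by blast
  then have A: "comm_group ?A"
    using sK by (intro group.group_comm_groupI) (auto simp: E.subgroup_imp_group subgroup.mem_carrier)
  have B: "comm_group ?B"
    using sR central by (intro group.group_comm_groupI)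
      (auto simp: U.subgroup_imp_group subgroup.mem_carrier R_def)
  have "bij_betw i (carrier M) K"
    using i exact by (auto simp: bij_betw_def mon_def K_def)
  then have card_K: "card K = card (carrier (schur_multiplier G))"
    using iso_same_card[OF schur] bij_betw_same_card by metis
  have "finite (carrier M)"
    using schur finite_schur_multiplier[OF G fin] by (auto simp: is_iso_def iso_def bij_betw_finite)
  then have fin_K: "finite K" using exact by (metis K_def finite_imageI)
  have image: "\<psi> ` R = K"
  proof (intro equalityI subsetI)
    fix e assume "e \<in> \<psi> ` R"
    then show "e \<in> K" using lift by (auto simp: R_iff K_iff)
  next
    fix e assume e: "e \<in> K"
    then obtain u where "u \<in> carrier U" "e = \<psi> u"
      using \<psi> unfolding epi_def K_iff by (metis (mono_tags, lifting) imageE mem_Collect_eq)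
    then show "e \<in> \<psi> ` R" using e lift by (auto simp: R_iff K_iff)
  qed
  define pull where "pull \<chi> = (\<lambda>a\<in>R. \<chi> (\<psi> a))" for \<chi> :: "_ \<Rightarrow> complex"
  have pull_char: "pull \<chi> \<in> characters ?B" if \<chi>: "\<chi> \<in> characters ?A" for \<chi>
  proof -
    have "\<psi> a \<in> K" if "a \<in> R" for a using that image by blast
    then show ?thesis
      using character_mult[OF \<chi>] character_nonzero[OF \<chi>] subgroup.m_closed[OF sR] subgroup.mem_carrier[OF sR]
      by (auto simp: characters_def hom_def pull_def)
  qed
  have "inj_on pull (characters ?A)"
  proof (rule inj_onI)
    fix \<chi> \<chi>' assume \<chi>: "\<chi> \<in> characters ?A" "\<chi>' \<in> characters ?A" and eq: "pull \<chi> = pull \<chi>'"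
    have "\<chi> e = \<chi>' e" if e: "e \<in> K" for e
    proof -
      obtain a where "a \<in> R" "e = \<psi> a" using e image by blast
      then show ?thesis using fun_cong[OF eq, of a] by (simp add: pull_def)
    qed
    moreover have "\<chi> \<in> extensional K" "\<chi>' \<in> extensional K" using \<chi> by (auto simp: characters_def)
    ultimately show "\<chi> = \<chi>'" by (meson extensionalityI)
  qed
  then have "card (pull ` characters ?A) = card (carrier (schur_multiplier G))"
    using card_characters[OF A] fin_K card_K by (simp add: card_image)
  moreover have "finite (characters ?B)" "card (characters ?B) \<le> card (carrier (schur_multiplier G))"
    unfolding R_def by (rule kernel_characters_embed[OF U G fin \<theta>]; fact central no_chars)+
  ultimately have all_pulled: "pull ` characters ?A = characters ?B"
    using pull_char by (intro card_seteq) auto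
  show ?thesis
    unfolding \<psi>.inj_on_one_iff
  proof (intro allI impI, rule ccontr)
    fix u assume u: "u \<in> carrier U" "\<psi> u = \<one>\<^bsub>E\<^esub>" and ne: "u \<noteq> \<one>\<^bsub>U\<^esub>"
    have "\<theta> u = \<one>\<^bsub>G\<^esub>" using lift[OF u(1)] u(2) by simp
    then have uR: "u \<in> R" using u by (simp add: R_iff)
    obtain \<chi> where \<chi>: "\<chi> \<in> characters ?B" "\<chi> u \<noteq> 1"
      using characters_separate_points[OF B, of u] uR ne by auto
    then obtain \<chi>' where \<chi>': "\<chi>' \<in> characters ?A" "\<chi> = pull \<chi>'" using all_pulled by blast
    have "\<chi> u = \<chi>' \<one>\<^bsub>E\<^esub>" using uR u by (simp add: \<chi>' pull_def)
    also have "\<dots> = 1" using character_one[OF E.subgroup_imp_group[OF sK] \<chi>'(1)] by simp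
    finally show False using \<chi>(2) by simp
  qed
qed

section \<open>Lifting homomorphisms from free groups\<close>

text \<open>This generalises \<^const>\<open>word_value\<close>: the generators are first sent to another group by \<open>t\<close>.\<close>

definition word_eval :: "('e, 'r) monoid_scheme \<Rightarrow> ('a \<Rightarrow> 'e) \<Rightarrow> (bool \<times> 'a) list \<Rightarrow> 'e" where
  "word_eval E t w = foldr (\<lambda>(s, x) g. (if s then t x else inv\<^bsub>E\<^esub> (t x)) \<otimes>\<^bsub>E\<^esub> g) w \<one>\<^bsub>E\<^esub>"

lemma word_value_eq_word_eval: "word_value F w = word_eval F (\<lambda>x. x) w"
  by (simp add: word_value_def word_eval_def)

lemma word_eval_Nil [simp]: "word_eval E t [] = \<one>\<^bsub>E\<^esub>"
  by (simp add: word_eval_def)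

lemma word_eval_Cons [simp]:
  "word_eval E t ((s, x) # w) = (if s then t x else inv\<^bsub>E\<^esub> (t x)) \<otimes>\<^bsub>E\<^esub> word_eval E t w"
  by (simp add: word_eval_def)

context group
begin

lemma word_eval_closed:
  "set w \<subseteq> UNIV \<times> B \<Longrightarrow> t ` B \<subseteq> carrier G \<Longrightarrow> word_eval G t w \<in> carrier G"
  by (induction w) auto

lemma word_eval_append:
  "set v \<subseteq> UNIV \<times> B \<Longrightarrow> set w \<subseteq> UNIV \<times> B \<Longrightarrow> t ` B \<subseteq> carrier G \<Longrightarrow>
   word_eval G t (v @ w) = word_eval G t v \<otimes> word_eval G t w"
proof (induction v)
  case (Cons a v)
  then show ?case
    by (cases a) (auto simp: m_assoc word_eval_closed image_subset_iff)
qed (auto simp: word_eval_closed)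

end

lemma (in group_hom) hom_word_eval:
  "set w \<subseteq> UNIV \<times> B \<Longrightarrow> t ` B \<subseteq> carrier G \<Longrightarrow>
   h (word_eval G t w) = word_eval H (\<lambda>x. h (t x)) w"
proof (induction w)
  case (Cons a w)
  then show ?case
    by (cases a) (auto simp: G.word_eval_closed image_subset_iff)
qed simp

lemma word_eval_cong:
  "set w \<subseteq> UNIV \<times> B \<Longrightarrow> (\<And>x. x \<in> B \<Longrightarrow> t x = t' x) \<Longrightarrow> word_eval E t w = word_eval E t' w"
  by (induction w) auto

fun cancel_Cons :: "bool \<times> 'a \<Rightarrow> (bool \<times> 'a) list \<Rightarrow> (bool \<times> 'a) list" where
  "cancel_Cons a [] = [a]"
| "cancel_Cons a (b # w) = (if snd a = snd b \<and> fst a \<noteq> fst b then w else a # b # w)"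

text \<open>Free reduction, letter by letter from the right: prepending a letter to a reduced word keeps it
  reduced if the letter is cancelled against an inverse first letter.\<close>

definition reduce :: "(bool \<times> 'a) list \<Rightarrow> (bool \<times> 'a) list" where
  "reduce w = foldr cancel_Cons w []"

lemma reduce_in_reduced_words:
  assumes "set w \<subseteq> UNIV \<times> B"
  shows "reduce w \<in> reduced_words B"
  using assms
proof (induction w)
  case Nil
  then show ?case by (simp add: reduce_def reduced_words_def)
next
  case (Cons a w)
  then have "reduce w \<in> reduced_words B" by simp
  moreover have "cancel_Cons a v \<in> reduced_words B" if "v \<in> reduced_words B" for v
    using that Cons.prems
    by (cases v) (auto simp: reduced_words_def successively_Cons split: prod.splits)
  ultimately show ?case by (simp add: reduce_def)
qed

lemma (in group) word_eval_reduce: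
  assumes "set w \<subseteq> UNIV \<times> B" "t ` B \<subseteq> carrier G"
  shows "word_eval G t (reduce w) = word_eval G t w"
  using assms(1)
proof (induction w)
  case Nil
  then show ?case by (simp add: reduce_def)
next
  case (Cons a w)
  have "set (reduce w) \<subseteq> UNIV \<times> B"
    using reduce_in_reduced_words[of w B] Cons.prems by (simp add: reduced_words_def)
  moreover have "word_eval G t (cancel_Cons a v) = word_eval G t (a # v)"
    if v: "set v \<subseteq> UNIV \<times> B" for v
  proof (cases v)
    case (Cons b u)
    obtain s x s' y where [simp]: "a = (s, x)" "b = (s', y)" by fastforce
    have "t x \<in> carrier G" "t y \<in> carrier G" "word_eval G t u \<in> carrier G"
      using assms(2) Cons.prems v Cons by (auto intro: word_eval_closed[of _ B])
    then show ?thesis using Cons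
      by (auto simp: m_assoc[symmetric])
  qed simp
  ultimately show ?case using Cons by (cases a) (simp add: reduce_def)
qed

text \<open>Free groups are projective.  Choose preimages under \<open>p\<close> of the images of the basis elements and
  evaluate the reduced spelling of an element at these.  For the product of two elements, the
  concatenation of their spellings reduces to the spelling of the product, and reduction
  does not change values in any group.\<close>

lemma free_group_lift:
  assumes F: "free_group F" and p: "p \<in> epi E G" and q: "q \<in> hom F G"
    and E: "group E" and G: "group G"
  obtains \<phi> where "\<phi> \<in> hom F E" "\<And>x. x \<in> carrier F \<Longrightarrow> p (\<phi> x) = q x"
proof -
  obtain B where B: "B \<subseteq> carrier F" and bij: "bij_betw (word_value F) (reduced_words B) (carrier F)"
    and "group F"
    using F by (auto simp: free_group_def)
  interpret F: group F by fact
  interpret E: group E by fact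
  have p_hom: "p \<in> hom E G" and p_surj: "p ` carrier E = carrier G"
    using p by (auto simp: epi_def)
  interpret p: group_hom E G p
    using E G p_hom by (simp add: group_hom_def group_hom_axioms_def)
  interpret q: group_hom F G q
    using F.is_group G q by (simp add: group_hom_def group_hom_axioms_def)
  have "\<forall>b\<in>B. \<exists>e\<in>carrier E. p e = q b"
    using p_surj q.hom_closed B by (metis imageE subsetD)
  then obtain t where t: "\<And>b. b \<in> B \<Longrightarrow> t b \<in> carrier E \<and> p (t b) = q b" by metis
  then have tE: "t ` B \<subseteq> carrier E" by auto
  have idF: "(\<lambda>x. x) ` B \<subseteq> carrier F" using B by simp
  define spell where "spell = inv_into (reduced_words B) (word_value F)"
  have spell: "spell x \<in> reduced_words B" "word_eval F (\<lambda>x. x) (spell x) = x" if "x \<in> carrier F" for x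
    using bij that unfolding spell_def bij_betw_def word_value_eq_word_eval[symmetric]
    by (auto intro: inv_into_into f_inv_into_f)
  have spell_eq: "spell (word_eval F (\<lambda>x. x) w) = w" if "w \<in> reduced_words B" for w
    using bij that unfolding spell_def bij_betw_def word_value_eq_word_eval[symmetric]
    by (auto intro: inv_into_f_f)
  have set_spell: "set (spell x) \<subseteq> UNIV \<times> B" if "x \<in> carrier F" for x
    using spell(1)[OF that] by (simp add: reduced_words_def)
  define \<phi> where "\<phi> x = word_eval E t (spell x)" for x
  have "\<phi> \<in> hom F E"
  proof (rule homI)
    show "\<phi> x \<in> carrier E" if "x \<in> carrier F" for x
      unfolding \<phi>_def by (rule E.word_eval_closed[OF set_spell[OF that] tE])
    fix x y assume xy: "x \<in> carrier F" "y \<in> carrier F"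
    let ?w = "spell x @ spell y"
    have w: "set ?w \<subseteq> UNIV \<times> B" using set_spell xy by simp
    have "word_eval F (\<lambda>x. x) (reduce ?w) = x \<otimes>\<^bsub>F\<^esub> y"
      using F.word_eval_reduce[OF w idF] F.word_eval_append[OF set_spell set_spell idF] spell(2) xy
      by simp
    then have "spell (x \<otimes>\<^bsub>F\<^esub> y) = reduce ?w"
      using spell_eq[OF reduce_in_reduced_words[OF w]] by simp
    then show "\<phi> (x \<otimes>\<^bsub>F\<^esub> y) = \<phi> x \<otimes>\<^bsub>E\<^esub> \<phi> y"
      using E.word_eval_reduce[OF w tE] E.word_eval_append[OF set_spell set_spell tE] xy
      by (simp add: \<phi>_def)
  qed
  moreover have "p (\<phi> x) = q x" if x: "x \<in> carrier F" for x
  proof -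
    have "p (\<phi> x) = word_eval G (\<lambda>b. p (t b)) (spell x)"
      unfolding \<phi>_def by (rule p.hom_word_eval[OF set_spell[OF x] tE])
    also have "\<dots> = word_eval G q (spell x)"
      using t by (intro word_eval_cong[OF set_spell[OF x]]) auto
    also have "\<dots> = q (word_eval F (\<lambda>x. x) (spell x))"
      by (rule q.hom_word_eval[OF set_spell[OF x] idF, symmetric])
    finally show ?thesis using spell(2)[OF x] by simp
  qed
  ultimately show thesis using that by blast
qed

section \<open>The cover inside a presentation\<close>

text \<open>Multiplying the entries of a commutator by elements with central image does not change its image,
  so if \<open>F = D N\<close> then every commutator may be replaced by one of elements of \<open>D\<close>.\<close>

lemma hom_commutator_supplement:
  assumes F: "group F" and N: "N \<subseteq> carrier F" and D: "D \<subseteq> carrier F"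
    and DN: "\<And>x. x \<in> carrier F \<Longrightarrow> \<exists>d\<in>D. \<exists>n\<in>N. x = d \<otimes>\<^bsub>F\<^esub> n"
    and h: "h \<in> hom F Q" and Q: "group Q"
    and central: "\<And>n z. n \<in> N \<Longrightarrow> z \<in> carrier Q \<Longrightarrow> h n \<otimes>\<^bsub>Q\<^esub> z = z \<otimes>\<^bsub>Q\<^esub> h n"
    and x: "x \<in> carrier F" and y: "y \<in> carrier F"
  obtains d d' where "d \<in> D" "d' \<in> D" "h (commutator F x y) = h (commutator F d d')"
proof -
  interpret h: group_hom F Q h using F Q h by (simp add: group_hom_def group_hom_axioms_def)
  obtain d n where d: "d \<in> D" "n \<in> N" "x = d \<otimes>\<^bsub>F\<^esub> n" using DN[OF x] by blast
  obtain d' n' where d': "d' \<in> D" "n' \<in> N" "y = d' \<otimes>\<^bsub>F\<^esub> n'" using DN[OF y] by blast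
  have inF: "d \<in> carrier F" "n \<in> carrier F" "d' \<in> carrier F" "n' \<in> carrier F"
    using d d' D N by auto
  have "h (commutator F x y) = commutator Q (h d \<otimes>\<^bsub>Q\<^esub> h n) (h d' \<otimes>\<^bsub>Q\<^esub> h n')"
    using x y inF by (simp only: h.hom_commutator d d' h.hom_mult)
  also have "\<dots> = commutator Q (h d) (h d')"
    using inF central d(2) d'(2) by (intro h.H.commutator_mult_central) auto
  also have "\<dots> = h (commutator F d d')"
    using inF by (simp only: h.hom_commutator)
  finally show thesis using that d d' by blast
qed

text \<open>Since \<open>G\<close> is perfect, \<open>q\<close> maps \<open>D\<close> onto \<open>G\<close>, that is, \<open>F = D N\<close>.  Likewise \<open>E\<close> is generated by
  \<open>\<phi>(F)\<close> and the central kernel of \<open>p\<close>, whence \<open>[E, E] = \<phi>(D)\<close>; the condition \<open>i(M) \<le> [E, E]\<close> on a cover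
  makes \<open>E\<close> perfect, so \<open>\<phi>\<close> maps \<open>D\<close> onto \<open>E\<close>.  The group \<open>D/C\<close>, with \<open>C = [F, N]\<close>, is a central
  extension of \<open>G\<close> without nontrivial characters, because modulo \<open>C\<close> every commutator in \<open>F\<close> is a
  commutator of elements of \<open>D\<close>.  So \<open>cover_surjection_injective\<close> applies to \<open>D/C \<rightarrow> E\<close>.\<close>

lemma cover_of_presentation:
  assumes G: "group G" and fin: "finite (carrier G)" and perfect: "perfect_group G"
    and cover: "is_cover M E G i p"
    and F: "free_group F" and q: "q \<in> epi F G"
  defines "N \<equiv> kernel F G q" and "D \<equiv> derived F (carrier F)"
  obtains \<phi> where "\<phi> \<in> hom F E" "\<And>x. x \<in> carrier F \<Longrightarrow> p (\<phi> x) = q x" "\<phi> ` D = carrier E"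
    "\<And>d. d \<in> D \<Longrightarrow> \<phi> d = \<one>\<^bsub>E\<^esub> \<longleftrightarrow> d \<in> commutator_with F N"
proof -
  have E: "group E" and p: "p \<in> epi E G"
    and exact: "i ` carrier M = kernel E G p"
    and i_central: "\<And>m e. m \<in> carrier M \<Longrightarrow> e \<in> carrier E \<Longrightarrow> i m \<otimes>\<^bsub>E\<^esub> e = e \<otimes>\<^bsub>E\<^esub> i m"
    and i_derived: "i ` carrier M \<subseteq> derived E (carrier E)"
    using cover by (auto simp: is_cover_def central_extension_def short_exact_def)
  have grF: "group F" using F by (simp add: free_group_def)
  interpret E: group E by fact
  interpret F: group F by fact
  interpret q: group_hom F G q
    using grF G q by (simp add: group_hom_def group_hom_axioms_def epi_def)
  interpret p: group_hom E G p
    using E G p by (simp add: group_hom_def group_hom_axioms_def epi_def)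
  have surj_q: "q ` carrier F = carrier G" and surj_p: "p ` carrier E = carrier G"
    using p q by (auto simp: epi_def)
  obtain \<phi> where \<phi>: "\<phi> \<in> hom F E" and lift: "\<And>x. x \<in> carrier F \<Longrightarrow> p (\<phi> x) = q x"
    using free_group_lift[OF F p q.homh E G] by blast
  interpret \<phi>: group_hom F E \<phi>
    using grF E \<phi> by (simp add: group_hom_def group_hom_axioms_def)
  define C where "C = commutator_with F N"
  have N: "N \<lhd> F" unfolding N_def by (rule q.normal_kernel)
  have N_iff: "x \<in> N \<longleftrightarrow> x \<in> carrier F \<and> q x = \<one>\<^bsub>G\<^esub>" for x by (simp add: N_def kernel_def)
  have C: "C \<lhd> F" unfolding C_def by (rule F.normal_commutator_with[OF N])
  have sC: "subgroup C F" by (rule normal_imp_subgroup[OF C])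
  have sD: "subgroup D F" unfolding D_def by (rule F.derived_is_subgroup) simp
  have DF: "D \<subseteq> carrier F" by (rule subgroup.subset[OF sD])
  have CD: "C \<subseteq> D"
    unfolding C_def D_def using N_iff by (intro F.commutator_with_subset_derived) auto
  have C_central: "C #>\<^bsub>F\<^esub> (n \<otimes>\<^bsub>F\<^esub> x) = C #>\<^bsub>F\<^esub> (x \<otimes>\<^bsub>F\<^esub> n)"
    if "n \<in> N" "x \<in> carrier F" for n x
    unfolding C_def by (rule F.commutator_with_central[OF N that(2,1)])
  have K_central: "k \<otimes>\<^bsub>E\<^esub> e = e \<otimes>\<^bsub>E\<^esub> k" if "k \<in> carrier E" "p k = \<one>\<^bsub>G\<^esub>" "e \<in> carrier E" for k e
  proof -
    have "k \<in> i ` carrier M" using that unfolding exact by (simp add: kernel_def)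
    then show ?thesis using i_central that by blast
  qed
  have \<phi>N_central: "\<phi> n \<otimes>\<^bsub>E\<^esub> e = e \<otimes>\<^bsub>E\<^esub> \<phi> n" if "n \<in> N" "e \<in> carrier E" for n e
    using that lift N_iff by (intro K_central) auto
  have qD: "q ` D = carrier G"
    using q.derived_img[of "carrier F"] perfect surj_q by (simp add: D_def perfect_group_def)
  have DN: "\<exists>d\<in>D. \<exists>n\<in>N. x = d \<otimes>\<^bsub>F\<^esub> n" if x: "x \<in> carrier F" for x
  proof -
    obtain d where d: "d \<in> D" "q d = q x"
      using qD q.hom_closed[OF x] by (metis imageE)
    then have "d \<in> carrier F" using DF by blast
    then have "inv\<^bsub>F\<^esub> d \<otimes>\<^bsub>F\<^esub> x \<in> N" "x = d \<otimes>\<^bsub>F\<^esub> (inv\<^bsub>F\<^esub> d \<otimes>\<^bsub>F\<^esub> x)"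
      using x d(2) by (simp_all add: N_iff F.inv_cancel_left)
    then show ?thesis using d(1) by blast
  qed
  \<comment> \<open>\<open>\<phi>\<close> maps \<open>N\<close> into the central kernel of \<open>p\<close>\<close>
  have \<phi>C: "C \<subseteq> kernel F E \<phi>"
    unfolding C_def
  proof (rule F.commutator_with_subsetI[OF \<phi>.subgroup_kernel])
    fix x y assume x: "x \<in> carrier F" and y: "y \<in> N"
    have yF: "y \<in> carrier F" using y N_iff by blast
    have "\<phi> (commutator F x y) = (\<phi> x \<otimes>\<^bsub>E\<^esub> \<phi> y) \<otimes>\<^bsub>E\<^esub> inv\<^bsub>E\<^esub> (\<phi> y \<otimes>\<^bsub>E\<^esub> \<phi> x)"
      using x yF by (simp add: E.group_word_simps)
    also have "\<dots> = \<one>\<^bsub>E\<^esub>"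
      using \<phi>N_central[OF y \<phi>.hom_closed[OF x]] x yF by simp
    finally show "commutator F x y \<in> kernel F E \<phi>" using x yF by (simp add: kernel_def)
  qed
  have \<phi>D: "\<phi> ` D = carrier E"
  proof
    show "\<phi> ` D \<subseteq> carrier E" using DF by auto
    have s: "subgroup (\<phi> ` D) E" by (rule \<phi>.subgroup_img_is_subgroup[OF sD])
    have "derived E (carrier E) \<subseteq> \<phi> ` D"
    proof (rule E.derived_subsetI[OF s])
      have fibre: "\<exists>f\<in>carrier F. \<exists>k\<in>kernel E G p. e = \<phi> f \<otimes>\<^bsub>E\<^esub> k" if e: "e \<in> carrier E" for e
      proof -
        obtain f where f: "f \<in> carrier F" "q f = p e"
          using surj_q p.hom_closed[OF e] by (metis imageE)
        have "inv\<^bsub>E\<^esub> (\<phi> f) \<otimes>\<^bsub>E\<^esub> e \<in> kernel E G p" "e = \<phi> f \<otimes>\<^bsub>E\<^esub> (inv\<^bsub>E\<^esub> (\<phi> f) \<otimes>\<^bsub>E\<^esub> e)"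
          using e f lift by (simp_all add: kernel_def E.inv_cancel_left)
        then show ?thesis using f(1) by blast
      qed
      fix e e' assume "e \<in> carrier E" "e' \<in> carrier E"
      then obtain f k f' k' where f: "f \<in> carrier F" "k \<in> kernel E G p" "e = \<phi> f \<otimes>\<^bsub>E\<^esub> k"
        and f': "f' \<in> carrier F" "k' \<in> kernel E G p" "e' = \<phi> f' \<otimes>\<^bsub>E\<^esub> k'"
        using fibre by meson
      have "commutator E e e' = commutator E (\<phi> f) (\<phi> f')"
        unfolding f(3) f'(3) using f f' K_central
        by (intro E.commutator_mult_central) (auto simp: kernel_def)
      also have "\<dots> = \<phi> (commutator F f f')" using f f' by (simp only: \<phi>.hom_commutator)
      finally show "commutator E e e' \<in> \<phi> ` D"
        using F.commutator_in_derived[OF f(1) f'(1)] by (simp add: D_def)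
    qed
    moreover have "carrier E \<subseteq> derived E (carrier E)"
    proof
      fix e assume e: "e \<in> carrier E"
      have "p ` derived E (carrier E) = carrier G"
        using p.derived_img[of "carrier E"] perfect surj_p by (simp add: perfect_group_def)
      then obtain d where d: "d \<in> derived E (carrier E)" "p d = p e"
        using p.hom_closed[OF e] by (metis imageE)
      have dE: "d \<in> carrier E" using d(1) E.derived_in_carrier[of "carrier E"] by blast
      have "inv\<^bsub>E\<^esub> d \<otimes>\<^bsub>E\<^esub> e \<in> i ` carrier M"
        unfolding exact using e d dE by (simp add: kernel_def)
      then have "d \<otimes>\<^bsub>E\<^esub> (inv\<^bsub>E\<^esub> d \<otimes>\<^bsub>E\<^esub> e) \<in> derived E (carrier E)"
        using i_derived d(1) subgroup.m_closed[OF E.derived_is_subgroup[of "carrier E"]] by blast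
      then show "e \<in> derived E (carrier E)" using e dE by (simp add: E.inv_cancel_left)
    qed
    ultimately show "carrier E \<subseteq> \<phi> ` D" by blast
  qed
  let ?D = "F\<lparr>carrier := D\<rparr>"
  define U where "U = ?D Mod C"
  have grD: "group ?D" by (rule F.subgroup_imp_group[OF sD])
  have CD_normal: "C \<lhd> ?D" by (rule F.normal_restrict_supergroup[OF sD C CD])
  interpret CD: normal C ?D by fact
  have grU: "group U" unfolding U_def by (rule CD.factorgroup_is_group)
  have coset_D: "C #>\<^bsub>?D\<^esub> x = C #>\<^bsub>F\<^esub> x" for x by (simp add: r_coset_def)
  have carrier_U: "carrier U = (\<lambda>d. C #>\<^bsub>F\<^esub> d) ` D"
    by (auto simp: U_def FactGroup_def RCOSETS_def coset_D)
  have mult_U: "(C #>\<^bsub>F\<^esub> x) \<otimes>\<^bsub>U\<^esub> (C #>\<^bsub>F\<^esub> y) = C #>\<^bsub>F\<^esub> (x \<otimes>\<^bsub>F\<^esub> y)" if "x \<in> D" "y \<in> D" for x y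
    using CD.rcos_sum[of x y] that by (simp add: U_def FactGroup_def coset_D)
  have qDG: "group_hom ?D G q" and \<phi>DE: "group_hom ?D E \<phi>"
    using grD G E q.homh \<phi> DF
    by (auto simp: group_hom_def group_hom_axioms_def hom_def subset_iff)
  have CN: "C \<subseteq> N" unfolding C_def by (rule F.commutator_with_subset_normal[OF N])
  obtain \<theta> where \<theta>: "\<theta> \<in> hom U G" "\<And>d. d \<in> D \<Longrightarrow> \<theta> (C #>\<^bsub>F\<^esub> d) = q d"
  proof (rule group_hom.FactGroup_universal_kernel[OF qDG CD_normal])
    show "C \<subseteq> kernel ?D G q" using CN CD N_iff by (auto simp: kernel_def)
  qed (auto simp: U_def coset_D)
  obtain \<psi> where \<psi>: "\<psi> \<in> hom U E" "\<And>d. d \<in> D \<Longrightarrow> \<psi> (C #>\<^bsub>F\<^esub> d) = \<phi> d"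
  proof (rule group_hom.FactGroup_universal_kernel[OF \<phi>DE CD_normal])
    show "C \<subseteq> kernel ?D E \<phi>" using \<phi>C CD by (auto simp: kernel_def)
  qed (auto simp: U_def coset_D)
  have \<theta>_epi: "\<theta> \<in> epi U G"
    using \<theta> qD by (simp add: epi_def carrier_U image_image)
  have \<psi>_epi: "\<psi> \<in> epi U E"
    using \<psi> \<phi>D by (simp add: epi_def carrier_U image_image)
  have inj: "inj_on \<psi> (carrier U)"
  proof (rule cover_surjection_injective[OF G fin cover grU \<theta>_epi _ _ \<psi>_epi])
    fix r u assume r: "r \<in> kernel U G \<theta>" and u: "u \<in> carrier U"
    obtain n x where n: "n \<in> D" "r = C #>\<^bsub>F\<^esub> n" and x: "x \<in> D" "u = C #>\<^bsub>F\<^esub> x"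
      using r u by (auto simp: kernel_def carrier_U)
    have "n \<in> N" using r n \<theta>(2) DF by (auto simp: kernel_def N_iff)
    then have "C #>\<^bsub>F\<^esub> (n \<otimes>\<^bsub>F\<^esub> x) = C #>\<^bsub>F\<^esub> (x \<otimes>\<^bsub>F\<^esub> n)"
      using x(1) DF by (intro C_central) auto
    then show "r \<otimes>\<^bsub>U\<^esub> u = u \<otimes>\<^bsub>U\<^esub> r"
      unfolding n(2) x(2) by (simp only: mult_U n(1) x(1))
  next
    fix u assume "u \<in> carrier U"
    then obtain d where "d \<in> D" "u = C #>\<^bsub>F\<^esub> d" by (auto simp: carrier_U)
    then show "p (\<psi> u) = \<theta> u" using \<theta>(2) \<psi>(2) lift DF by auto
  next
    fix \<kappa> u assume \<kappa>: "\<kappa> \<in> hom U complex_units" and u: "u \<in> carrier U"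
    interpret \<kappa>: group_hom U complex_units \<kappa>
      using grU \<kappa> by (simp add: group_hom_def group_hom_axioms_def)
    interpret \<rho>: group_hom ?D U "\<lambda>d. C #>\<^bsub>F\<^esub> d"
      using grD grU CD.r_coset_hom_Mod by (simp add: group_hom_def group_hom_axioms_def U_def coset_D)
    interpret \<rho>F: group_hom F "F Mod C" "\<lambda>x. C #>\<^bsub>F\<^esub> x"
      using grF normal.r_coset_hom_Mod[OF C] normal.factorgroup_is_group[OF C]
      by (simp add: group_hom_def group_hom_axioms_def)
    let ?L = "{d \<in> D. \<kappa> (C #>\<^bsub>F\<^esub> d) = 1}"
    have "subgroup (kernel ?D complex_units (\<kappa> \<circ> (\<lambda>d. C #>\<^bsub>F\<^esub> d))) ?D"
      using group_hom.subgroup_kernel[of ?D complex_units] hom_compose[OF \<rho>.homh \<kappa>] grD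
      by (simp add: group_hom_def group_hom_axioms_def)
    then have "subgroup ?L ?D" by (simp add: kernel_def)
    then have L: "subgroup ?L F" by (rule F.incl_subgroup[OF sD])
    have "D \<subseteq> ?L"
      unfolding D_def
    proof (fold D_def, rule subset_trans[OF _ F.derived_subsetI[OF L]])
      show "D \<subseteq> derived F (carrier F)" by (simp add: D_def)
      fix x y assume xy: "x \<in> carrier F" "y \<in> carrier F"
      have "(C #>\<^bsub>F\<^esub> n) \<otimes>\<^bsub>F Mod C\<^esub> z = z \<otimes>\<^bsub>F Mod C\<^esub> (C #>\<^bsub>F\<^esub> n)"
        if n: "n \<in> N" and z: "z \<in> carrier (F Mod C)" for n z
      proof -
        obtain x where x: "x \<in> carrier F" "z = C #>\<^bsub>F\<^esub> x"
          using z by (auto simp: FactGroup_def RCOSETS_def)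
        have nF: "n \<in> carrier F" using n N_iff by blast
        show ?thesis
          unfolding x(2) \<rho>F.hom_mult[OF nF x(1), symmetric] \<rho>F.hom_mult[OF x(1) nF, symmetric]
          by (rule C_central[OF n x(1)])
      qed
      then obtain d d' where d: "d \<in> D" "d' \<in> D" and
        eq: "C #>\<^bsub>F\<^esub> commutator F x y = C #>\<^bsub>F\<^esub> commutator F d d'"
        using hom_commutator_supplement[OF grF subgroup.subset[OF normal_imp_subgroup[OF N]] DF DN \<rho>F.homh \<rho>F.H.is_group _ xy] by metis
      have inv_D: "inv\<^bsub>?D\<^esub> a = inv\<^bsub>F\<^esub> a" if "a \<in> D" for a
        using F.m_inv_consistent[OF sD that] .
      have dD: "d \<in> carrier ?D" "d' \<in> carrier ?D" using d by simp_all
      have "\<kappa> (C #>\<^bsub>F\<^esub> commutator ?D d d') = commutator complex_units (\<kappa> (C #>\<^bsub>F\<^esub> d)) (\<kappa> (C #>\<^bsub>F\<^esub> d'))"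
        unfolding \<rho>.hom_commutator[OF dD] by (rule \<kappa>.hom_commutator[OF dD[THEN \<rho>.hom_closed]])
      also have "\<dots> = 1"
        using \<kappa>.hom_closed[OF \<rho>.hom_closed, of d] \<kappa>.hom_closed[OF \<rho>.hom_closed, of d'] d
        by (simp add: field_simps)
      finally have "\<kappa> (C #>\<^bsub>F\<^esub> commutator F x y) = 1" using d by (simp add: eq inv_D)
      then show "commutator F x y \<in> ?L"
        using F.commutator_in_derived[OF xy] by (simp add: D_def)
    qed
    then show "\<kappa> u = 1" using u by (auto simp: carrier_U)
  qed
  have "d \<in> C" if d: "d \<in> D" "\<phi> d = \<one>\<^bsub>E\<^esub>" for d
  proof -
    have "\<psi> (C #>\<^bsub>F\<^esub> d) = \<psi> (C #>\<^bsub>F\<^esub> \<one>\<^bsub>F\<^esub>)"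
      using \<psi>(2) d subgroup.one_closed[OF sD] by simp
    then have "C #>\<^bsub>F\<^esub> d = C #>\<^bsub>F\<^esub> \<one>\<^bsub>F\<^esub>"
      using inj d(1) subgroup.one_closed[OF sD] by (auto simp: carrier_U dest!: inj_onD)
    then show ?thesis
      using F.rcos_self[OF _ sC, of d] DF d(1) F.coset_mult_one[of C] subgroup.subset[OF sC] by auto
  qed
  moreover have "\<phi> d = \<one>\<^bsub>E\<^esub>" if "d \<in> C" for d using \<phi>C that by (auto simp: kernel_def)
  ultimately have "\<phi> d = \<one>\<^bsub>E\<^esub> \<longleftrightarrow> d \<in> commutator_with F N" if "d \<in> D" for d
    unfolding C_def using that by blast
  with \<phi> lift \<phi>D show thesis by (rule that)
qed

section \<open>The normal closure of \<open>\<K>(N, n)\<close>\<close>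

text \<open>The index sets \<open>{1..n}\<close> are to keep this form during simplification.\<close>

declare One_nat_def [simp del]

lemma ordered_product_0 [simp]: "ordered_product G 0 f = \<one>\<^bsub>G\<^esub>"
  by (simp add: ordered_product_def)

context group
begin

lemma foldr_mult_closed:
  "(\<And>i. i \<in> set is \<Longrightarrow> f i \<in> carrier G) \<Longrightarrow> b \<in> carrier G \<Longrightarrow>
   foldr (\<lambda>i h. f i \<otimes> h) is b \<in> carrier G"
  by (induction "is") auto

lemma foldr_mult_base:
  "(\<And>i. i \<in> set is \<Longrightarrow> f i \<in> carrier G) \<Longrightarrow> b \<in> carrier G \<Longrightarrow>
   foldr (\<lambda>i h. f i \<otimes> h) is b = foldr (\<lambda>i h. f i \<otimes> h) is \<one> \<otimes> b"
  by (induction "is") (auto simp: m_assoc foldr_mult_closed)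

lemma ordered_product_Suc:
  assumes "\<And>i. i \<in> {1..Suc n} \<Longrightarrow> f i \<in> carrier G"
  shows "ordered_product G (Suc n) f = ordered_product G n f \<otimes> f (Suc n)"
proof -
  have "ordered_product G (Suc n) f = foldr (\<lambda>i h. f i \<otimes> h) [1..<Suc n] (f (Suc n) \<otimes> \<one>)"
    by (simp add: ordered_product_def)
  also have "\<dots> = ordered_product G n f \<otimes> (f (Suc n) \<otimes> \<one>)"
    unfolding ordered_product_def using assms by (intro foldr_mult_base) auto
  finally show ?thesis using assms by simp
qed

lemma ordered_product_closed:
  assumes "\<And>i. i \<in> {1..n} \<Longrightarrow> f i \<in> carrier G"
  shows "ordered_product G n f \<in> carrier G"
  unfolding ordered_product_def using assms by (intro foldr_mult_closed) auto

lemma ordered_product_in_subgroup: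
  assumes "subgroup H G" and "\<And>i. i \<in> {1..n} \<Longrightarrow> f i \<in> H"
  shows "ordered_product G n f \<in> H"
  using group.ordered_product_closed[OF subgroup_imp_group[OF assms(1)], of n f] assms(2)
  by (simp add: ordered_product_def)

lemma ordered_product_single:
  assumes k: "k \<in> {1..n}" and x: "x \<in> carrier G"
    and f: "\<And>i. i \<in> {1..n} \<Longrightarrow> f i = (if i = k then x else \<one>)"
  shows "ordered_product G n f = x"
proof -
  have "ordered_product G m f = (if k \<le> m then x else \<one>)" if "m \<le> n" for m
    using that
  proof (induction m)
    case 0
    then show ?case using k by simp
  next
    case (Suc m)
    have "ordered_product G (Suc m) f = ordered_product G m f \<otimes> f (Suc m)"
      using Suc.prems f x by (intro ordered_product_Suc) auto
    then show ?case using Suc f x k by auto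
  qed
  from this[of n] show ?thesis using k by simp
qed

end

text \<open>For noncommuting factors the ordered product is not multiplicative in the tuple.  It is modulo any
  homomorphism under which the entries commute.  This serves twice: for all of \<open>F\<close> over its
  abelianisation, and for \<open>N\<close> over \<open>F/[F, N]\<close>.\<close>

lemma ordered_product_mult_central:
  assumes F: "group F" and Q: "group Q" and h: "h \<in> hom F Q" and H: "H \<subseteq> carrier F"
    and central: "\<And>x z. x \<in> H \<Longrightarrow> z \<in> h ` H \<Longrightarrow> h x \<otimes>\<^bsub>Q\<^esub> z = z \<otimes>\<^bsub>Q\<^esub> h x"
    and sub: "subgroup H F"
    and f: "f \<in> {1..n} \<rightarrow>\<^sub>E H" and g: "g \<in> {1..n} \<rightarrow>\<^sub>E H"
  shows "h (ordered_product F n (f \<otimes>\<^bsub>group_power F n\<^esub> g)) =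
     h (ordered_product F n f) \<otimes>\<^bsub>Q\<^esub> h (ordered_product F n g)"
proof -
  interpret F: group F by fact
  interpret h: group_hom F Q h using F Q h by (simp add: group_hom_def group_hom_axioms_def)
  have closed: "ordered_product F m k \<in> H" if "m \<le> n" "k \<in> {1..n} \<rightarrow>\<^sub>E H" for m k
    using that by (intro F.ordered_product_in_subgroup[OF sub]) auto
  define k where "k = f \<otimes>\<^bsub>group_power F n\<^esub> g"
  have k: "k i = f i \<otimes>\<^bsub>F\<^esub> g i" if "i \<in> {1..n}" for i using that by (simp add: k_def)
  have fF: "f i \<in> carrier F" "g i \<in> carrier F" if "i \<in> {1..n}" for i
    using f g H that by (auto dest!: PiE_mem)
  have "h (ordered_product F m k) =
     h (ordered_product F m f) \<otimes>\<^bsub>Q\<^esub> h (ordered_product F m g)" if "m \<le> n" for m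
    using that
  proof (induction m)
    case (Suc m)
    let ?a = "ordered_product F m f" and ?b = "ordered_product F m g"
    have inH: "?a \<in> H" "?b \<in> H" "f (Suc m) \<in> H" "g (Suc m) \<in> H"
      using closed[of m] f g Suc.prems by auto
    have inF: "?a \<in> carrier F" "?b \<in> carrier F" "f (Suc m) \<in> carrier F" "g (Suc m) \<in> carrier F"
      using inH H by auto
    have k_closed: "ordered_product F m k \<in> carrier F"
      using k fF Suc.prems by (intro F.ordered_product_closed) auto
    have "ordered_product F (Suc m) k = ordered_product F m k \<otimes>\<^bsub>F\<^esub> k (Suc m)"
      using k fF Suc.prems by (intro F.ordered_product_Suc) auto
    then have "h (ordered_product F (Suc m) k) =
        h ?a \<otimes>\<^bsub>Q\<^esub> h ?b \<otimes>\<^bsub>Q\<^esub> (h (f (Suc m)) \<otimes>\<^bsub>Q\<^esub> h (g (Suc m)))"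
      using Suc k[of "Suc m"] inF k_closed by simp
    also have "\<dots> = h ?a \<otimes>\<^bsub>Q\<^esub> (h ?b \<otimes>\<^bsub>Q\<^esub> h (f (Suc m))) \<otimes>\<^bsub>Q\<^esub> h (g (Suc m))"
      using inF by (simp add: h.H.m_assoc)
    also have "h ?b \<otimes>\<^bsub>Q\<^esub> h (f (Suc m)) = h (f (Suc m)) \<otimes>\<^bsub>Q\<^esub> h ?b"
      using central inH by blast
    also have "h ?a \<otimes>\<^bsub>Q\<^esub> (h (f (Suc m)) \<otimes>\<^bsub>Q\<^esub> h ?b) \<otimes>\<^bsub>Q\<^esub> h (g (Suc m)) =
        h (ordered_product F (Suc m) f) \<otimes>\<^bsub>Q\<^esub> h (ordered_product F (Suc m) g)"
    proof -
      have "ordered_product F (Suc m) f = ?a \<otimes>\<^bsub>F\<^esub> f (Suc m)" "ordered_product F (Suc m) g = ?b \<otimes>\<^bsub>F\<^esub> g (Suc m)"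
        using fF Suc.prems by (auto intro!: F.ordered_product_Suc)
      then show ?thesis using inF by (simp add: h.H.m_assoc)
    qed
    finally show ?case .
  qed simp
  then show ?thesis by (simp add: k_def)
qed

lemma ordered_product_cong_hom:
  assumes F: "group F" and Q: "group Q" and h: "h \<in> hom F Q"
    and f: "\<And>i. i \<in> {1..n} \<Longrightarrow> f i \<in> carrier F" and g: "\<And>i. i \<in> {1..n} \<Longrightarrow> g i \<in> carrier F"
    and eq: "\<And>i. i \<in> {1..n} \<Longrightarrow> h (f i) = h (g i)"
  shows "h (ordered_product F n f) = h (ordered_product F n g)"
proof -
  interpret F: group F by fact
  interpret h: group_hom F Q h using F Q h by (simp add: group_hom_def group_hom_axioms_def)
  have "h (ordered_product F m f) = h (ordered_product F m g)" if "m \<le> n" for m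
    using that
  proof (induction m)
    case (Suc m)
    have "ordered_product F (Suc m) f = ordered_product F m f \<otimes>\<^bsub>F\<^esub> f (Suc m)"
      "ordered_product F (Suc m) g = ordered_product F m g \<otimes>\<^bsub>F\<^esub> g (Suc m)"
      using f g Suc.prems by (auto intro!: F.ordered_product_Suc)
    moreover have "ordered_product F m f \<in> carrier F" "ordered_product F m g \<in> carrier F"
      using f g Suc.prems by (auto intro!: F.ordered_product_closed)
    ultimately show ?case
      using Suc f[of "Suc m"] g[of "Suc m"] eq[of "Suc m"] by simp
  qed simp
  then show ?thesis by simp
qed

lemma (in group) K_subgroup_iff:
  "f \<in> K_subgroup G n \<longleftrightarrow>
     f \<in> {1..n} \<rightarrow>\<^sub>E carrier G \<and> ordered_product G n f \<in> derived G (carrier G)"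
proof -
  let ?D = "derived G (carrier G)"
  have sD: "subgroup ?D G" by (rule derived_is_subgroup) simp
  have "?D #> x = ?D \<longleftrightarrow> x \<in> ?D" if "x \<in> carrier G" for x
    using coset_join1[OF _ that sD] coset_join2[OF that sD] by blast
  moreover have "ordered_product G n f \<in> carrier G" if "f \<in> {1..n} \<rightarrow>\<^sub>E carrier G"
    using that by (intro ordered_product_closed) auto
  ultimately show ?thesis
    by (auto simp: K_subgroup_def kernel_def abelianization_def FactGroup_def)
qed

lemma (in group) K_subgroup_subgroup:
  "subgroup (K_subgroup G n) (group_power G n)"
proof -
  let ?D = "derived G (carrier G)"
  interpret D: normal ?D G by (rule derived_self_is_normal)
  interpret Q: comm_group "G Mod ?D" by (rule derived_quot_is_comm_group)
  have "(\<lambda>f. ?D #> ordered_product G n f) \<in> hom (group_power G n) (G Mod ?D)"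
  proof (rule homI)
    fix f assume "f \<in> carrier (group_power G n)"
    then show "?D #> ordered_product G n f \<in> carrier (G Mod ?D)"
      by (auto simp: FactGroup_def RCOSETS_def intro!: bexI[of _ "ordered_product G n f"] ordered_product_closed)
  next
    fix f g assume fg: "f \<in> carrier (group_power G n)" "g \<in> carrier (group_power G n)"
    show "?D #> ordered_product G n (f \<otimes>\<^bsub>group_power G n\<^esub> g) =
        (?D #> ordered_product G n f) \<otimes>\<^bsub>G Mod ?D\<^esub> (?D #> ordered_product G n g)"
    proof (rule ordered_product_mult_central[OF is_group Q.is_group D.r_coset_hom_Mod subset_refl])
      fix x z assume "x \<in> carrier G" "z \<in> (\<lambda>x. ?D #> x) ` carrier G"
      then show "(?D #> x) \<otimes>\<^bsub>G Mod ?D\<^esub> z = z \<otimes>\<^bsub>G Mod ?D\<^esub> (?D #> x)"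
        by (intro Q.m_comm) (auto simp: FactGroup_def RCOSETS_def)
    qed (use fg subgroup_self in auto)
  qed
  then have "group_hom (group_power G n) (G Mod ?D) (\<lambda>f. ?D #> ordered_product G n f)"
    using Q.is_group by (simp add: group_hom_def group_hom_axioms_def)
  then show ?thesis
    using group_hom.subgroup_kernel by (simp only: K_subgroup_def abelianization_def)
qed

abbreviation single :: "('a, 'r) monoid_scheme \<Rightarrow> nat \<Rightarrow> nat \<Rightarrow> 'a \<Rightarrow> nat \<Rightarrow> 'a" where
  "single G n k x \<equiv> (\<lambda>i\<in>{1..n}. if i = k then x else \<one>\<^bsub>G\<^esub>)"

lemma (in group) ordered_product_mult_single:
  assumes f: "\<And>i. i \<in> {1..n} \<Longrightarrow> f i \<in> carrier G" and c: "c \<in> carrier G" and n: "n \<noteq> 0"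
  shows "ordered_product G n (f \<otimes>\<^bsub>group_power G n\<^esub> single G n n c) = ordered_product G n f \<otimes> c"
proof -
  obtain m where m: "n = Suc m" using n by (cases n) auto
  let ?g = "f \<otimes>\<^bsub>group_power G n\<^esub> single G n n c"
  have g: "?g i = (if i = n then f n \<otimes> c else f i)" if "i \<in> {1..n}" for i
    using that f by simp
  have m_eq: "ordered_product G m ?g = ordered_product G m f"
    unfolding ordered_product_def using m f g by (intro foldr_cong) auto
  have "ordered_product G n ?g = ordered_product G m ?g \<otimes> ?g n"
    unfolding m using g f c by (intro ordered_product_Suc) (simp add: m)
  also have "\<dots> = ordered_product G m f \<otimes> (f n \<otimes> c)"
    using g[of n] m unfolding m_eq by simp
  also have "\<dots> = ordered_product G m f \<otimes> f n \<otimes> c"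
    using m f c ordered_product_closed[of m f] by (simp add: m_assoc)
  also have "ordered_product G m f \<otimes> f n = ordered_product G n f"
    unfolding m using f m by (intro ordered_product_Suc[symmetric]) simp
  finally show ?thesis .
qed

text \<open>The right-hand side \<open>S\<close> is normal because the class of the ordered product modulo \<open>C = [G, N]\<close> is
  a homomorphism on \<open>N\<^sup>n\<close> that is invariant under conjugation in \<open>G\<^sup>n\<close>.  Conversely, let \<open>H\<close> be a normal
  subgroup containing \<open>\<K>(N, n)\<close>.  For \<open>y \<in> N\<close> the tuple \<open>(y\<^sup>-\<^sup>1, 1, \<dots>, 1, y)\<close> has product 1.  Its
  commutator with \<open>(1, \<dots>, 1, x)\<close> is \<open>(1, \<dots>, 1, [x, y])\<close>, so \<open>H\<close> contains \<open>(1, \<dots>, 1, c)\<close> for all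
  \<open>c \<in> C\<close>.  Correcting the last entry of a tuple in \<open>S\<close> by its product gives an element of \<open>\<K>(N, n)\<close>.
  The hypothesis \<open>n \<ge> 2\<close> makes the first and the last coordinate distinct.\<close>

lemma (in group) normal_closure_K_subgroup:
  assumes N: "N \<lhd> G" and n: "n \<ge> 2"
  shows "normal_closure (group_power G n) (K_subgroup (G\<lparr>carrier := N\<rparr>) n) =
       {f \<in> {1..n} \<rightarrow>\<^sub>E N. ordered_product G n f \<in> commutator_with G N}"
      (is "normal_closure ?P ?K = ?S")
    and "{f \<in> {1..n} \<rightarrow>\<^sub>E N. ordered_product G n f \<in> commutator_with G N} \<lhd> group_power G n"
proof -
  interpret N: normal N G by fact
  define C where "C = commutator_with G N"
  have C: "C \<lhd> G" unfolding C_def by (rule normal_commutator_with[OF N])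
  interpret C: normal C G by fact
  have sN: "subgroup N G" and sC: "subgroup C G"
    using N C by (simp_all add: normal_imp_subgroup)
  have CN: "C \<subseteq> N" unfolding C_def by (rule commutator_with_subset_normal[OF N])
  interpret P: group ?P by simp
  interpret Q: group "G Mod C" by (rule C.factorgroup_is_group)
  interpret \<rho>: group_hom G "G Mod C" "\<lambda>x. C #> x"
    using is_group Q.is_group C.r_coset_hom_Mod by (simp add: group_hom_def group_hom_axioms_def)
  have central: "C #> (y \<otimes> x) = C #> (x \<otimes> y)" if "x \<in> carrier G" "y \<in> N" for x y
    unfolding C_def by (rule commutator_with_central[OF N that])
  have C_iff: "C #> x = C \<longleftrightarrow> x \<in> C" if "x \<in> carrier G" for x
    using coset_join1[OF _ that sC] coset_join2[OF that sC] by blast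
  have op_N: "ordered_product G n f \<in> carrier G" if "f \<in> {1..n} \<rightarrow>\<^sub>E N" for f
    using that by (intro ordered_product_closed) (auto dest!: PiE_mem)
  interpret GN: group "G\<lparr>carrier := N\<rparr>" by (rule subgroup_imp_group[OF sN])
  have sPN: "subgroup ({1..n} \<rightarrow>\<^sub>E N) ?P"
    using sN by (subst PiE_subgroup_product_group) auto
  have hom: "(\<lambda>f. C #> ordered_product G n f) \<in> hom (?P\<lparr>carrier := {1..n} \<rightarrow>\<^sub>E N\<rparr>) (G Mod C)"
  proof (rule homI)
    fix f assume "f \<in> carrier (?P\<lparr>carrier := {1..n} \<rightarrow>\<^sub>E N\<rparr>)"
    then show "C #> ordered_product G n f \<in> carrier (G Mod C)"
      using op_N by (auto simp: FactGroup_def RCOSETS_def)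
  next
    fix f g
    assume fg: "f \<in> carrier (?P\<lparr>carrier := {1..n} \<rightarrow>\<^sub>E N\<rparr>)" "g \<in> carrier (?P\<lparr>carrier := {1..n} \<rightarrow>\<^sub>E N\<rparr>)"
    have "C #> ordered_product G n (f \<otimes>\<^bsub>?P\<^esub> g) =
        (C #> ordered_product G n f) \<otimes>\<^bsub>G Mod C\<^esub> (C #> ordered_product G n g)"
    proof (rule ordered_product_mult_central[OF is_group Q.is_group \<rho>.homh _ _ sN])
      fix x z assume x: "x \<in> N" and "z \<in> (\<lambda>x. C #> x) ` N"
      then obtain y where y: "y \<in> N" "z = C #> y" by blast
      show "(C #> x) \<otimes>\<^bsub>G Mod C\<^esub> z = z \<otimes>\<^bsub>G Mod C\<^esub> (C #> x)"
        using central[of y x] x y \<rho>.hom_mult[of x y] \<rho>.hom_mult[of y x] by simp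
    qed (use fg subgroup.subset[OF sN] in auto)
    then show "C #> ordered_product G n (f \<otimes>\<^bsub>?P\<lparr>carrier := {1..n} \<rightarrow>\<^sub>E N\<rparr>\<^esub> g) =
        (C #> ordered_product G n f) \<otimes>\<^bsub>G Mod C\<^esub> (C #> ordered_product G n g)" by simp
  qed
  have S_eq: "?S = kernel (?P\<lparr>carrier := {1..n} \<rightarrow>\<^sub>E N\<rparr>) (G Mod C) (\<lambda>f. C #> ordered_product G n f)"
    using op_N C_iff by (auto simp: kernel_def C_def[symmetric])
  have "group_hom (?P\<lparr>carrier := {1..n} \<rightarrow>\<^sub>E N\<rparr>) (G Mod C) (\<lambda>f. C #> ordered_product G n f)"
    using hom Q.is_group P.subgroup_imp_group[OF sPN] by (simp add: group_hom_def group_hom_axioms_def)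
  then have sS: "subgroup ?S ?P"
    unfolding S_eq using P.incl_subgroup[OF sPN] group_hom.subgroup_kernel by blast
  have normal_S: "?S \<lhd> ?P"
    unfolding P.normal_inv_iff
  proof (intro conjI ballI sS)
    fix x f assume x: "x \<in> carrier ?P" and f: "f \<in> ?S"
    have val: "(x \<otimes>\<^bsub>?P\<^esub> f \<otimes>\<^bsub>?P\<^esub> inv\<^bsub>?P\<^esub> x) i = x i \<otimes> f i \<otimes> inv (x i)" if "i \<in> {1..n}" for i
      using x that by (simp add: inv_product_group)
    have xf: "x i \<in> carrier G" "f i \<in> N" if "i \<in> {1..n}" for i using x f that by auto
    have inN: "x \<otimes>\<^bsub>?P\<^esub> f \<otimes>\<^bsub>?P\<^esub> inv\<^bsub>?P\<^esub> x \<in> {1..n} \<rightarrow>\<^sub>E N"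
    proof (rule PiE_I)
      show "(x \<otimes>\<^bsub>?P\<^esub> f \<otimes>\<^bsub>?P\<^esub> inv\<^bsub>?P\<^esub> x) i \<in> N" if "i \<in> {1..n}" for i
        unfolding val[OF that] using N.inv_op_closed2[OF xf[OF that]] .
    qed (simp only: mult_product_group restrict_apply if_False)
    have "C #> ordered_product G n (x \<otimes>\<^bsub>?P\<^esub> f \<otimes>\<^bsub>?P\<^esub> inv\<^bsub>?P\<^esub> x) = C #> ordered_product G n f"
    proof (rule ordered_product_cong_hom[OF is_group Q.is_group \<rho>.homh])
      fix i assume i: "i \<in> {1..n}"
      note xi = xf[OF i]
      have fi: "f i \<in> carrier G" using xi by simp
      show "(x \<otimes>\<^bsub>?P\<^esub> f \<otimes>\<^bsub>?P\<^esub> inv\<^bsub>?P\<^esub> x) i \<in> carrier G"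
        using PiE_mem[OF inN i] by (rule N.mem_carrier)
      show "f i \<in> carrier G" by fact
      have "C #> (x i \<otimes> f i \<otimes> inv (x i)) = (C #> (x i \<otimes> f i)) \<otimes>\<^bsub>G Mod C\<^esub> (C #> inv (x i))"
        using xi fi by (intro \<rho>.hom_mult) auto
      also have "C #> (x i \<otimes> f i) = C #> (f i \<otimes> x i)" by (rule central[OF xi, symmetric])
      also have "(C #> (f i \<otimes> x i)) \<otimes>\<^bsub>G Mod C\<^esub> (C #> inv (x i)) = C #> (f i \<otimes> x i \<otimes> inv (x i))"
        using xi fi by (intro \<rho>.hom_mult[symmetric]) auto
      also have "f i \<otimes> x i \<otimes> inv (x i) = f i" using xi fi by (simp add: m_assoc)
      finally show "C #> (x \<otimes>\<^bsub>?P\<^esub> f \<otimes>\<^bsub>?P\<^esub> inv\<^bsub>?P\<^esub> x) i = C #> f i" unfolding val[OF i] .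
    qed
    then have "ordered_product G n (x \<otimes>\<^bsub>?P\<^esub> f \<otimes>\<^bsub>?P\<^esub> inv\<^bsub>?P\<^esub> x) \<in> C"
      using f C_iff op_N[OF inN] op_N[of f] by (metis (no_types, lifting) C_def mem_Collect_eq)
    then show "x \<otimes>\<^bsub>?P\<^esub> f \<otimes>\<^bsub>?P\<^esub> inv\<^bsub>?P\<^esub> x \<in> ?S" using inN by (simp add: C_def)
  qed
  have op_GN: "ordered_product (G\<lparr>carrier := N\<rparr>) n f = ordered_product G n f" for f
    by (simp add: ordered_product_def)
  have K_iff: "f \<in> ?K \<longleftrightarrow> f \<in> {1..n} \<rightarrow>\<^sub>E N \<and> ordered_product G n f \<in> derived G N" for f
    using GN.K_subgroup_iff[of f n] derived_consistent[OF subset_refl sN] by (simp add: op_GN)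
  have "derived G N \<subseteq> C"
    unfolding derived_def
    by (rule generate_subgroup_incl[OF _ sC]) (auto simp: C_def intro!: commutator_in_commutator_with)
  then have KS: "?K \<subseteq> ?S" unfolding C_def using K_iff by blast
  have "?S \<subseteq> H" if H: "H \<lhd> ?P" and KH: "?K \<subseteq> H" for H
  proof
    interpret H: normal H ?P by fact
    have one_derived: "\<one> \<in> derived G N" unfolding derived_def by (rule generate.one)
    define e where "e = single G n n"
    have "group_hom G ?P e"
      by (auto simp: e_def group_hom_def group_hom_axioms_def hom_def is_group fun_eq_iff)
    then interpret s: group_hom G ?P e .
    let ?L = "{x \<in> carrier G. e x \<in> H}"
    have sL: "subgroup ?L G"
    proof (rule subgroupI)
      have "e \<one> \<in> H" unfolding s.hom_one by (rule H.one_closed)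
      then show "?L \<noteq> {}" by blast
      show "inv a \<in> ?L" if "a \<in> ?L" for a
        using that H.m_inv_closed[of "e a"] s.hom_inv[of a] by (metis (no_types, lifting) inv_closed mem_Collect_eq)
      show "a \<otimes> b \<in> ?L" if "a \<in> ?L" "b \<in> ?L" for a b
        using that H.m_closed[of "e a" "e b"] s.hom_mult[of a b] by (metis (no_types, lifting) m_closed mem_Collect_eq)
    qed auto
    have "C \<subseteq> ?L"
      unfolding C_def
    proof (rule commutator_with_subsetI[OF sL])
      fix x y assume x: "x \<in> carrier G" and y: "y \<in> N"
      have yG: "y \<in> carrier G" using y by simp
      define t where "t = single G n 1 (inv y) \<otimes>\<^bsub>?P\<^esub> single G n n y"
      have n1: "n \<noteq> 1" using n by simp
      have tP: "t \<in> carrier ?P" using yG by (auto simp: t_def)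
      have t_val: "t i = (if i = 1 then inv y else if i = n then y else \<one>)" if "i \<in> {1..n}" for i
        using that n1 yG by (simp add: t_def)
      have "ordered_product G m t = (if m = 0 then \<one> else if m < n then inv y else \<one>)" if "m \<le> n" for m
        using that
      proof (induction m)
        case (Suc m)
        have "ordered_product G (Suc m) t = ordered_product G m t \<otimes> t (Suc m)"
          using tP Suc.prems by (intro ordered_product_Suc) auto
        then show ?case using Suc n yG by (auto simp: t_val)
      qed simp
      from this[of n] have "ordered_product G n t = \<one>" by simp
      moreover have "t \<in> {1..n} \<rightarrow>\<^sub>E N" using y n by (auto simp: t_def)
      ultimately have tH: "t \<in> H" using KH one_derived by (auto simp: K_iff)
      have "e x \<otimes>\<^bsub>?P\<^esub> t \<otimes>\<^bsub>?P\<^esub> inv\<^bsub>?P\<^esub> (e x) \<otimes>\<^bsub>?P\<^esub> inv\<^bsub>?P\<^esub> t \<in> H"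
        by (rule H.m_closed[OF H.inv_op_closed2[OF s.hom_closed[OF x] tH] H.m_inv_closed[OF tH]])
      also have "e x \<otimes>\<^bsub>?P\<^esub> t \<otimes>\<^bsub>?P\<^esub> inv\<^bsub>?P\<^esub> (e x) \<otimes>\<^bsub>?P\<^esub> inv\<^bsub>?P\<^esub> t
          = e (commutator G x y)"
        using tP s.hom_closed[OF x] x yG n1
        by (auto simp: e_def fun_eq_iff inv_product_group t_val)
      finally have "e (commutator G x y) \<in> H" .
      moreover have "commutator G x y \<in> carrier G" using x yG by simp
      ultimately show "commutator G x y \<in> ?L" by blast
    qed
    then have single_H: "e c \<in> H" if "c \<in> C" for c using that by blast
    fix f assume f: "f \<in> ?S"
    define c where "c = ordered_product G n f"
    have c: "c \<in> C" "c \<in> carrier G" using f op_N[of f] by (simp_all add: c_def C_def)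
    have fN: "f i \<in> N" if "i \<in> {1..n}" for i using f that by auto
    have fP: "f \<in> carrier ?P" using f fN by (auto simp: PiE_iff)
    define g where "g = f \<otimes>\<^bsub>?P\<^esub> e (inv c)"
    have "ordered_product G n g = ordered_product G n f \<otimes> inv c"
      unfolding g_def e_def using n c fN by (intro ordered_product_mult_single) auto
    then have "ordered_product G n g = \<one>" using c by (simp add: c_def[symmetric])
    moreover have "inv c \<in> N" using CN c(1) by blast
    then have "g \<in> {1..n} \<rightarrow>\<^sub>E N" using fN by (auto simp: g_def e_def)
    ultimately have "g \<in> ?K" unfolding K_iff using one_derived by simp
    then have "g \<in> H" using KH by blast
    then have "g \<otimes>\<^bsub>?P\<^esub> e c \<in> H" using single_H[OF c(1)] by (rule H.m_closed)
    moreover have "g \<otimes>\<^bsub>?P\<^esub> e c = f"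
      using fP c by (auto simp: g_def e_def fun_eq_iff PiE_iff extensional_def m_assoc)
    ultimately show "f \<in> H" by simp
  qed
  with normal_S KS show "normal_closure ?P ?K = ?S" unfolding normal_closure_def by blast
  show "?S \<lhd> ?P" by (rule normal_S)
qed

section \<open>The extension of \<open>G\<^sup>n\<^sup>-\<^sup>1\<close> by the cover\<close>

lemma mon_of_equal_kernels:
  assumes U: "group U" and A: "group A" and B: "group B"
    and a: "a \<in> epi U A" and b: "b \<in> hom U B"
    and ker: "\<And>x. x \<in> carrier U \<Longrightarrow> a x = \<one>\<^bsub>A\<^esub> \<longleftrightarrow> b x = \<one>\<^bsub>B\<^esub>"
  obtains \<iota> where "\<iota> \<in> mon A B" "\<And>x. x \<in> carrier U \<Longrightarrow> \<iota> (a x) = b x"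
proof -
  interpret U: group U by fact
  interpret a: group_hom U A a
    using U A a by (simp add: group_hom_def group_hom_axioms_def epi_def)
  interpret b: group_hom U B b
    using U B b by (simp add: group_hom_def group_hom_axioms_def)
  have surj: "\<And>y. y \<in> carrier A \<Longrightarrow> \<exists>x\<in>carrier U. a x = y"
    using a unfolding epi_def by (metis (mono_tags, lifting) imageE mem_Collect_eq)
  have eq_iff: "a x = a y \<longleftrightarrow> b x = b y" if x: "x \<in> carrier U" and y: "y \<in> carrier U" for x y
  proof -
    have "a x = a y \<longleftrightarrow> a (x \<otimes>\<^bsub>U\<^esub> inv\<^bsub>U\<^esub> y) = \<one>\<^bsub>A\<^esub>"
      using x y a.H.inv_solve_right'[of "\<one>\<^bsub>A\<^esub>" "a x" "a y"] by (auto simp: eq_commute)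
    also have "\<dots> \<longleftrightarrow> b (x \<otimes>\<^bsub>U\<^esub> inv\<^bsub>U\<^esub> y) = \<one>\<^bsub>B\<^esub>" using x y by (intro ker) simp
    also have "\<dots> \<longleftrightarrow> b x = b y"
      using x y b.H.inv_solve_right'[of "\<one>\<^bsub>B\<^esub>" "b x" "b y"] by (auto simp: eq_commute)
    finally show ?thesis .
  qed
  define \<iota> where "\<iota> y = b (SOME x. x \<in> carrier U \<and> a x = y)" for y
  have \<iota>: "\<iota> (a x) = b x" if x: "x \<in> carrier U" for x
  proof -
    have "\<exists>z. z \<in> carrier U \<and> a z = a x" using x by blast
    from someI_ex[OF this] show ?thesis using eq_iff x by (auto simp: \<iota>_def)
  qed
  have "\<iota> \<in> mon A B"
    unfolding mon_def
  proof (intro CollectI conjI homI inj_onI)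
    show "\<iota> y \<in> carrier B" if "y \<in> carrier A" for y
      using surj[OF that] \<iota> by auto
    show "\<iota> (y \<otimes>\<^bsub>A\<^esub> z) = \<iota> y \<otimes>\<^bsub>B\<^esub> \<iota> z" if yz: "y \<in> carrier A" "z \<in> carrier A" for y z
    proof -
      obtain u v where "u \<in> carrier U" "a u = y" "v \<in> carrier U" "a v = z" using surj yz by meson
      then show ?thesis using \<iota>[of "u \<otimes>\<^bsub>U\<^esub> v"] \<iota>[of u] \<iota>[of v] by auto
    qed
    show "y = z" if yz: "y \<in> carrier A" "z \<in> carrier A" "\<iota> y = \<iota> z" for y z
    proof -
      obtain u v where "u \<in> carrier U" "a u = y" "v \<in> carrier U" "a v = z" using surj yz by meson
      then show ?thesis using \<iota>[of u] \<iota>[of v] eq_iff[of u v] yz(3) by auto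
    qed
  qed
  then show thesis using that \<iota> by blast
qed

text \<open>The projection reads off the images of the first \<open>n - 1\<close> coordinates, and \<open>\<phi> d \<in> E\<close> is sent to the
  class of \<open>(1, \<dots>, 1, d)\<close>, which is well defined and injective since this tuple is a relation if and only
  if \<open>d \<in> [F, N]\<close>, that is, if and only if \<open>\<phi> d = 1\<close>.\<close>

lemma K_tilde_short_exact:
  assumes F: "group F" and G: "group G" and E: "group E" and q: "q \<in> epi F G" and n: "n \<ge> 2"
    and \<phi>: "\<phi> \<in> hom F E" and \<phi>D: "\<phi> ` derived F (carrier F) = carrier E"
    and ker_\<phi>: "\<And>d. d \<in> derived F (carrier F) \<Longrightarrow>
      \<phi> d = \<one>\<^bsub>E\<^esub> \<longleftrightarrow> d \<in> commutator_with F (kernel F G q)"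
  shows "\<exists>\<iota> \<pi>. short_exact E (K_tilde F (kernel F G q) n) (group_power G (n - 1)) \<iota> \<pi>"
proof -
  interpret F: group F by fact
  interpret G: group G by fact
  interpret q: group_hom F G q
    using F G q by (simp add: group_hom_def group_hom_axioms_def epi_def)
  define N where "N = kernel F G q"
  define C where "C = commutator_with F N"
  define D where "D = derived F (carrier F)"
  define P where "P = group_power F n"
  define K where "K = K_subgroup F n"
  define S where "S = {f \<in> {1..n} \<rightarrow>\<^sub>E N. ordered_product F n f \<in> C}"
  define PK where "PK = P\<lparr>carrier := K\<rparr>"
  define KT where "KT = K_tilde F N n"
  let ?G = "group_power G (n - 1)"
  have N: "N \<lhd> F" unfolding N_def by (rule q.normal_kernel)
  have N_iff: "x \<in> N \<longleftrightarrow> x \<in> carrier F \<and> q x = \<one>\<^bsub>G\<^esub>" for x by (simp add: N_def kernel_def)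
  have sN: "subgroup N F" by (rule normal_imp_subgroup[OF N])
  have NF: "N \<subseteq> carrier F" by (rule subgroup.subset[OF sN])
  have CN: "C \<subseteq> N" unfolding C_def by (rule F.commutator_with_subset_normal[OF N])
  have CD: "C \<subseteq> D" unfolding C_def D_def by (rule F.commutator_with_subset_derived[OF NF])
  have sD: "subgroup D F" unfolding D_def by (rule F.derived_is_subgroup) simp
  have DF: "D \<subseteq> carrier F" by (rule subgroup.subset[OF sD])
  have carrier_P: "carrier P = {1..n} \<rightarrow>\<^sub>E carrier F" by (simp add: P_def)
  have op_last: "ordered_product F n f = ordered_product F (n - 1) f \<otimes>\<^bsub>F\<^esub> f n" if "f \<in> carrier P" for f
  proof -
    have "f i \<in> carrier F" if "i \<in> {1..Suc (n - 1)}" for i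
      using \<open>f \<in> carrier P\<close> that n by (auto simp: carrier_P)
    then have "ordered_product F (Suc (n - 1)) f = ordered_product F (n - 1) f \<otimes>\<^bsub>F\<^esub> f (Suc (n - 1))"
      by (rule F.ordered_product_Suc)
    moreover have "Suc (n - 1) = n" using n by simp
    ultimately show ?thesis by simp
  qed
  have mult_P: "f \<otimes>\<^bsub>P\<^esub> g = (\<lambda>i\<in>{1..n}. f i \<otimes>\<^bsub>F\<^esub> g i)" for f g by (simp add: P_def)
  interpret P: group P unfolding P_def by simp
  have K_iff: "f \<in> K \<longleftrightarrow> f \<in> carrier P \<and> ordered_product F n f \<in> D" for f
    by (simp add: K_def F.K_subgroup_iff D_def carrier_P)
  have sK: "subgroup K P" unfolding K_def P_def by (rule F.K_subgroup_subgroup)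
  interpret PK: group PK unfolding PK_def by (rule P.subgroup_imp_group[OF sK])
  have SK: "S \<subseteq> K" 
  proof -
    have "{1..n} \<rightarrow>\<^sub>E N \<subseteq> {1..n} \<rightarrow>\<^sub>E carrier F" by (rule PiE_mono) (rule NF)
    then show ?thesis using CD unfolding S_def K_iff carrier_P subset_eq by blast
  qed
  have "S \<lhd> P" unfolding S_def C_def P_def by (rule F.normal_closure_K_subgroup(2)[OF N n])
  then have S: "S \<lhd> PK" unfolding PK_def using sK SK by (intro P.normal_restrict_supergroup)
  interpret S: normal S PK by fact
  have sS: "subgroup S PK" by (rule normal_imp_subgroup[OF S])
  have KT: "KT = PK Mod S"
    unfolding KT_def K_tilde_def F.normal_closure_K_subgroup(1)[OF N n]
    by (simp add: PK_def P_def K_def S_def C_def)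
  interpret KT: group KT unfolding KT by (rule S.factorgroup_is_group)
  interpret \<rho>: group_hom PK KT "\<lambda>f. S #>\<^bsub>PK\<^esub> f"
    using PK.is_group KT.is_group S.r_coset_hom_Mod by (simp add: group_hom_def group_hom_axioms_def KT)
  have carrier_KT: "carrier KT = (\<lambda>f. S #>\<^bsub>PK\<^esub> f) ` K"
    by (auto simp: KT FactGroup_def RCOSETS_def PK_def)
  have one_KT: "\<one>\<^bsub>KT\<^esub> = S" by (simp add: KT FactGroup_def)
  have \<rho>_iff: "S #>\<^bsub>PK\<^esub> f = S \<longleftrightarrow> f \<in> S" if "f \<in> K" for f
    using PK.coset_join1[OF _ _ sS, of f] PK.coset_join2[OF _ sS, of f] that by (auto simp: PK_def)
  define \<pi>0 where "\<pi>0 f = (\<lambda>i\<in>{1..n-1}. q (f i))" for f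
  have \<pi>0_hom: "\<pi>0 \<in> hom PK ?G"
  proof (rule homI)
    show "\<pi>0 f \<in> carrier ?G" if "f \<in> carrier PK" for f
    proof -
      have "f i \<in> carrier F" if "i \<in> {1..n}" for i
        using \<open>f \<in> carrier PK\<close> that by (auto simp: PK_def K_iff carrier_P)
      then show ?thesis by (auto simp: \<pi>0_def)
    qed
    show "\<pi>0 (f \<otimes>\<^bsub>PK\<^esub> g) = \<pi>0 f \<otimes>\<^bsub>?G\<^esub> \<pi>0 g" if fg: "f \<in> carrier PK" "g \<in> carrier PK" for f g
    proof -
      have "f i \<in> carrier F" "g i \<in> carrier F" if "i \<in> {1..n}" for i
        using fg that by (auto simp: PK_def K_iff carrier_P)
      then show ?thesis by (auto simp: \<pi>0_def PK_def mult_P fun_eq_iff)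
    qed
  qed
  have \<pi>0_group_hom: "group_hom PK ?G \<pi>0"
    using PK.is_group \<pi>0_hom by (simp add: group_hom_def group_hom_axioms_def)
  have S_kernel: "S \<subseteq> kernel PK ?G \<pi>0"
  proof
    fix f assume f: "f \<in> S"
    then have "q (f i) = \<one>\<^bsub>G\<^esub>" if "i \<in> {1..n}" for i
      using that N_iff by (auto simp: S_def)
    then show "f \<in> kernel PK ?G \<pi>0" using f SK by (auto simp: kernel_def PK_def \<pi>0_def fun_eq_iff)
  qed
  have carrier_PK: "carrier PK = K" by (simp add: PK_def)
  obtain \<pi> where \<pi>: "\<pi> \<in> hom KT ?G" "\<And>f. f \<in> K \<Longrightarrow> \<pi> (S #>\<^bsub>PK\<^esub> f) = \<pi>0 f"
    using group_hom.FactGroup_universal_kernel[OF \<pi>0_group_hom S S_kernel]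
    unfolding KT carrier_PK by blast
  have "\<pi>0 ` K = carrier ?G"
  proof
    show "\<pi>0 ` K \<subseteq> carrier ?G" using \<pi>0_hom by (auto simp: hom_def PK_def)
    show "carrier ?G \<subseteq> \<pi>0 ` K"
    proof
      fix g assume g: "g \<in> carrier ?G"
      have "\<forall>i\<in>{1..n-1}. \<exists>x\<in>carrier F. q x = g i"
        using g q by (auto simp: epi_def) (metis PiE_mem atLeastAtMost_iff imageE)
      then obtain t where t: "\<And>i. i \<in> {1..n-1} \<Longrightarrow> t i \<in> carrier F \<and> q (t i) = g i" by metis
      define c where "c = ordered_product F (n - 1) t"
      have c: "c \<in> carrier F" unfolding c_def using t by (intro F.ordered_product_closed) auto
      \<comment> \<open>the last coordinate, invisible to the projection, makes the product trivial\<close>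
      define f where "f = (\<lambda>i\<in>{1..n}. if i = n then inv\<^bsub>F\<^esub> c else t i)"
      have fP: "f \<in> carrier P" using t c by (auto simp: f_def carrier_P)
      have "ordered_product F (n - 1) f = c"
        unfolding c_def ordered_product_def using n by (intro foldr_cong) (auto simp: f_def)
      then have "ordered_product F n f = c \<otimes>\<^bsub>F\<^esub> inv\<^bsub>F\<^esub> c"
        using op_last[OF fP] n by (simp add: f_def)
      then have "f \<in> K" using c fP subgroup.one_closed[OF sD] by (simp add: K_iff)
      moreover have "\<pi>0 f = g"
        using g t n by (auto simp: \<pi>0_def f_def fun_eq_iff PiE_iff extensional_def)
      ultimately show "g \<in> \<pi>0 ` K" by blast
    qed
  qed
  then have \<pi>_epi: "\<pi> \<in> epi KT ?G"
    using \<pi> by (simp add: epi_def carrier_KT image_image)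
  let ?D = "F\<lparr>carrier := D\<rparr>"
  have grD: "group ?D" by (rule F.subgroup_imp_group[OF sD])
  have op_single: "ordered_product F n (single F n n d) = d" if "d \<in> carrier F" for d
    using n that by (intro F.ordered_product_single[of n]) auto
  have single_K: "single F n n d \<in> K" if "d \<in> D" for d
    using that DF op_single by (auto simp: K_iff carrier_P)
  have "single F n n \<in> hom ?D PK"
    using single_K DF by (auto simp: hom_def PK_def mult_P fun_eq_iff)
  then have incl_hom: "(\<lambda>f. S #>\<^bsub>PK\<^esub> f) \<circ> single F n n \<in> hom ?D KT"
    by (rule hom_compose) (rule \<rho>.homh)
  have \<phi>_epi: "\<phi> \<in> epi ?D E"
    using \<phi> \<phi>D DF by (auto simp: epi_def hom_def D_def[symmetric] subset_iff)
  have "\<phi> d = \<one>\<^bsub>E\<^esub> \<longleftrightarrow> ((\<lambda>f. S #>\<^bsub>PK\<^esub> f) \<circ> single F n n) d = \<one>\<^bsub>KT\<^esub>" if d: "d \<in> carrier ?D" for d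
  proof -
    have dD: "d \<in> D" using d by simp
    have "single F n n d \<in> S \<longleftrightarrow> d \<in> C"
      using op_single[of d] dD DF CN subgroup.one_closed[OF sN] by (auto simp: S_def)
    then show ?thesis
      using ker_\<phi>[of d] dD \<rho>_iff[OF single_K[OF dD]] by (simp add: one_KT D_def C_def N_def)
  qed
  then obtain \<iota> where \<iota>: "\<iota> \<in> mon E KT"
    "\<And>d. d \<in> D \<Longrightarrow> \<iota> (\<phi> d) = S #>\<^bsub>PK\<^esub> single F n n d"
    using mon_of_equal_kernels[OF grD E KT.is_group \<phi>_epi incl_hom] by (auto simp: o_def)
  have "\<iota> ` carrier E = kernel KT ?G \<pi>"
  proof
    show "\<iota> ` carrier E \<subseteq> kernel KT ?G \<pi>"
    proof
      fix z assume "z \<in> \<iota> ` carrier E"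
      then obtain d where d: "d \<in> D" "z = S #>\<^bsub>PK\<^esub> single F n n d"
        unfolding \<phi>D[folded D_def, symmetric] using \<iota>(2) by blast
      have "\<pi>0 (single F n n d) = \<one>\<^bsub>?G\<^esub>" using n by (auto simp: \<pi>0_def fun_eq_iff)
      then show "z \<in> kernel KT ?G \<pi>"
        using d \<pi>(2)[OF single_K[OF d(1)]] single_K[OF d(1)] by (simp add: kernel_def carrier_KT)
    qed
    show "kernel KT ?G \<pi> \<subseteq> \<iota> ` carrier E"
    proof
      fix z assume z: "z \<in> kernel KT ?G \<pi>"
      then obtain f where f: "f \<in> K" "z = S #>\<^bsub>PK\<^esub> f" by (auto simp: kernel_def carrier_KT)
      have "\<pi>0 f = \<one>\<^bsub>?G\<^esub>" using z \<pi>(2)[OF f(1)] f(2) by (simp add: kernel_def)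
      then have qf: "q (f i) = \<one>\<^bsub>G\<^esub>" if "i \<in> {1..n-1}" for i
      proof -
        have "\<pi>0 f i = \<one>\<^bsub>G\<^esub>" unfolding \<open>\<pi>0 f = \<one>\<^bsub>?G\<^esub>\<close> using that by simp
        then show ?thesis using that by (simp add: \<pi>0_def)
      qed
      have fF: "f i \<in> carrier F" if "i \<in> {1..n}" for i
        using f(1) that by (auto simp: K_iff carrier_P)
      have fN: "f i \<in> N" if i: "i \<in> {1..n-1}" for i
      proof -
        have "i \<in> {1..n}" using i by auto
        then show ?thesis using qf[OF i] fF by (simp add: N_iff)
      qed
      define d where "d = ordered_product F n f"
      have d: "d \<in> D" "d \<in> carrier F" using f(1) DF by (auto simp: K_iff d_def)
      have d_eq: "d = ordered_product F (n - 1) f \<otimes>\<^bsub>F\<^esub> f n"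
        unfolding d_def using f(1) by (intro op_last) (simp add: K_iff)
      have op_N: "ordered_product F (n - 1) f \<in> N"
        using fN by (intro F.ordered_product_in_subgroup[OF sN]) auto
      \<comment> \<open>\<open>f\<close> differs from \<open>(1, \<dots>, 1, d)\<close> by \<open>g\<close>, whose entries lie in \<open>N\<close> and whose product
        is 1, so that it is a relation\<close>
      define g where "g = f \<otimes>\<^bsub>PK\<^esub> single F n n (inv\<^bsub>F\<^esub> d)"
      have g_val: "g i = (if i = n then f n \<otimes>\<^bsub>F\<^esub> inv\<^bsub>F\<^esub> d else f i)" if "i \<in> {1..n}" for i
        using that fF[OF that] by (simp add: g_def PK_def mult_P)
      have inv_d: "inv\<^bsub>F\<^esub> d \<in> D" using subgroup.m_inv_closed[OF sD d(1)] .
      have g_op: "ordered_product F n g = \<one>\<^bsub>F\<^esub>"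
        using F.ordered_product_mult_single[of n f "inv\<^bsub>F\<^esub> d"] fF d n
        by (simp add: g_def PK_def P_def d_def[symmetric])
      have "g i \<in> N" if i: "i \<in> {1..n}" for i
      proof (cases "i = n")
        case True
        have "q d = q (f n)" using d_eq op_N fF[of n] n by (simp add: N_iff)
        then show ?thesis using True g_val[OF i] fF[of n] n d by (simp add: N_iff)
      next
        case False
        then show ?thesis using g_val[OF i] fN[of i] i by auto
      qed
      moreover have "g \<in> extensional {1..n}" by (simp add: g_def PK_def mult_P)
      ultimately have "g \<in> S"
        using g_op subgroup.one_closed[OF normal_imp_subgroup[OF F.normal_commutator_with[OF N]]]
        by (simp add: S_def PiE_iff C_def)
      moreover have "single F n n d \<in> carrier PK" "single F n n (inv\<^bsub>F\<^esub> d) \<in> carrier PK" "f \<in> carrier PK"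
        using single_K d inv_d f by (auto simp: PK_def)
      moreover have "f = g \<otimes>\<^bsub>PK\<^esub> single F n n d"
        using f(1) fF d by (auto simp: fun_eq_iff g_def PK_def mult_P F.m_assoc K_iff carrier_P PiE_iff extensional_def)
      ultimately have "f \<in> S #>\<^bsub>PK\<^esub> single F n n d" by (auto simp: r_coset_def)
      then have "z = S #>\<^bsub>PK\<^esub> single F n n d"
        using PK.repr_independence[OF _ _ sS] single_K[OF d(1)] f(2) by (simp add: PK_def)
      then have "z = \<iota> (\<phi> d)" using \<iota>(2) d by simp
      then show "z \<in> \<iota> ` carrier E" using \<phi>D d(1) by (auto simp: D_def[symmetric])
    qed
  qed
  then have "short_exact E KT ?G \<iota> \<pi>"
    using E KT.is_group \<iota>(1) \<pi>_epi by (simp add: short_exact_def)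
  then show ?thesis unfolding KT_def N_def by blast
qed

theorem proposition3p1:
  fixes G :: "'g monoid"
    and F :: "'f monoid" and N :: "'f set"
    and M :: "'m monoid" and G_univ :: "'e monoid"
    and i :: "'m \<Rightarrow> 'e" and p :: "'e \<Rightarrow> 'g"
    and n :: nat
  assumes "group G" and "finite (carrier G)" and "perfect_group G"
    and "n \<ge> 2"
    and "free_group F" and "N \<lhd> F" and "F Mod N \<cong> G"
    and "is_cover M G_univ G i p"
  shows "\<exists>\<iota> \<pi>. short_exact G_univ (K_tilde F N n) (group_power G (n - 1)) \<iota> \<pi>"
proof -
  have F: "group F" using \<open>free_group F\<close> by (simp add: free_group_def)
  have E: "group G_univ"
    using \<open>is_cover M G_univ G i p\<close> by (simp add: is_cover_def central_extension_def short_exact_def)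
  interpret F: group F by fact
  interpret N: normal N F by fact
  have sN: "subgroup N F" by (rule normal_imp_subgroup[OF \<open>N \<lhd> F\<close>])
  obtain j where j: "j \<in> iso (F Mod N) G" using \<open>F Mod N \<cong> G\<close> by (auto simp: is_iso_def)
  interpret j: group_hom "F Mod N" G j
    using j N.factorgroup_is_group \<open>group G\<close>
    by (simp add: group_hom_def group_hom_axioms_def iso_def)
  have j_inj: "inj_on j (carrier (F Mod N))" using j by (simp add: iso_def bij_betw_def)
  have carrier_Mod: "carrier (F Mod N) = (\<lambda>x. N #>\<^bsub>F\<^esub> x) ` carrier F"
    by (auto simp: FactGroup_def RCOSETS_def)
  define q where "q = j \<circ> (\<lambda>x. N #>\<^bsub>F\<^esub> x)"
  have "q \<in> hom F G"
    unfolding q_def by (rule hom_compose[OF N.r_coset_hom_Mod j.homh])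
  moreover have "q ` carrier F = carrier G"
    using j unfolding q_def image_comp[symmetric] carrier_Mod[symmetric]
    by (simp add: iso_def bij_betw_def)
  ultimately have q: "q \<in> epi F G" by (simp add: epi_def)
  have "kernel F G q = N"
  proof -
    have "q x = \<one>\<^bsub>G\<^esub> \<longleftrightarrow> x \<in> N" if x: "x \<in> carrier F" for x
    proof -
      have "N #>\<^bsub>F\<^esub> x \<in> carrier (F Mod N)" using x by (simp add: carrier_Mod)
      then have "q x = \<one>\<^bsub>G\<^esub> \<longleftrightarrow> N #>\<^bsub>F\<^esub> x = \<one>\<^bsub>F Mod N\<^esub>"
        using inj_onD[OF j_inj, of "N #>\<^bsub>F\<^esub> x" "\<one>\<^bsub>F Mod N\<^esub>"] j.hom_one j.G.one_closed
        unfolding q_def comp_apply by metis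
      also have "\<dots> \<longleftrightarrow> x \<in> N"
        using F.coset_join1[OF _ x sN] F.coset_join2[OF x sN] by (auto simp: FactGroup_def)
      finally show ?thesis .
    qed
    then show ?thesis using N.subset by (auto simp: kernel_def)
  qed
  moreover obtain \<phi> where "\<phi> \<in> hom F G_univ" "\<phi> ` derived F (carrier F) = carrier G_univ"
    "\<And>d. d \<in> derived F (carrier F) \<Longrightarrow>
       \<phi> d = \<one>\<^bsub>G_univ\<^esub> \<longleftrightarrow> d \<in> commutator_with F (kernel F G q)"
    using cover_of_presentation[OF assms(1,2,3,8,5) q] by metis
  ultimately show ?thesis
    using K_tilde_short_exact[OF F \<open>group G\<close> E q \<open>n \<ge> 2\<close>] by metis
qed

end
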